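(* Let $(W,S)$ be a Coxeter system of finite rank. The following are equivalent. (i) $p^{S'}_{Q,J,K}(t)$ is a rational function for every $Q,J,K\subset S'\subset S$. (ii) $p^{S'}_{Q,J,K}(t)$ is a rational function for every $Q,J,K\subset S'\subset S$ with $|K|=|S'|-1$. (iii) $p^{S'}_{K,J,K}(t)$ is a rational function for every $J,K\subset S'\subset S$. (iv) $h^{S'}_{R,J,K}(t)$ is a rational function for every $J,K\subset S'\subset S$ and $R\subset J$. (v) $h^{S'}_{R,J,K}(t)$ is a rational function for every $J,K\subset S'\subset S$ and $R\subset J$ with $|J|=|S'|-1$. (vi) $p^{S'}_{K,J,K}(t)=h^{S'}_{J,J,K}(t)$ is a rational function for every $J,K\subset S'\subset S$ with $|J|=|K|$. (vii) $p^{S'}_{K,J,K}(t)$ is a rational function for every $J,K\subset S'\subset S$ with $|J|=|K|$ and $J,K$ spherical. Moreover, if these conditions hold, then ${}^JW_{S'}^K(t)$ is a rational function for every $J,K\subset S'\subset S$.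
   Context: $(W,S)$ is a Coxeter system with $S$ finite and $\ell$ is its length function. The symbol $\subset$ allows equality. For $X\subset W$ the Poincaré series of $X$ is $X(t)=\sum_{x\in X}t^{\ell(x)}\in\mathbb{Z}[[t]]$; it is called a rational function if it is the power series expansion of an element of $\mathbb{Q}(t)$. For $J\subset S$, $W_J=\langle J\rangle$; $J$ is spherical if $W_J$ is finite. For $J,K\subset S'\subset S$, ${}^JW_{S'}^K$ is the set of $w\in W_{S'}$ with $\ell(sw)>\ell(w)$ for all $s\in J$ and $\ell(ws)>\ell(w)$ for all $s\in K$. For $Q,J,K\subset S'\subset S$, $p^{S'}_{Q,J,K}=\{x\in{}^JW_{S'}^K\mid K\cap x^{-1}Jx=Q\}$. For $J,K\subset S'\subset S$ and $R\subset J$, $h^{S'}_{R,J,K}=\{x\in{}^JW_{S'}^K\mid xKx^{-1}=R\}$. *)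

theory Defs
  imports
    "HOL-Algebra.Generated_Groups"
    "HOL-Algebra.Multiplicative_Group"
    "HOL-Computational_Algebra.Polynomial_FPS"
begin

section \<open>Coxeter systems\<close>

definition word_eval :: "('a, 'b) monoid_scheme \<Rightarrow> 'a list \<Rightarrow> 'a" where
  "word_eval W ws = foldr (\<lambda>x y. x \<otimes>\<^bsub>W\<^esub> y) ws \<one>\<^bsub>W\<^esub>"

text \<open>
  The congruence on words over \<open>S\<close> generated by the relations \<open>(s t)\<^sup>m = 1\<close>, where \<open>m\<close> is the
  order of \<open>s t\<close> in \<open>W\<close>. For \<open>s t\<close> of infinite order, \<^const>\<open>group.ord\<close> is \<open>0\<close> and the rule
  \<open>relator\<close> is vacuous.
  When the elements of \<open>S\<close> are involutions, the case \<open>s = t\<close> (with \<open>m = 1\<close>) makes every letter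
  its own inverse, so this monoid presentation is the group presentation
  \<open>\<langle>S | (s t)\<^sup>m\<rangle>\<close> and no formal inverse letters are needed.
\<close>

inductive word_equiv :: "('a, 'b) monoid_scheme \<Rightarrow> 'a set \<Rightarrow> 'a list \<Rightarrow> 'a list \<Rightarrow> bool"
  for W :: "('a, 'b) monoid_scheme" and S :: "'a set" where
  refl: "u \<in> lists S \<Longrightarrow> word_equiv W S u u"
| sym: "word_equiv W S u v \<Longrightarrow> word_equiv W S v u"
| trans: "word_equiv W S u v \<Longrightarrow> word_equiv W S v w \<Longrightarrow> word_equiv W S u w"
| relator: "u \<in> lists S \<Longrightarrow> v \<in> lists S \<Longrightarrow> s \<in> S \<Longrightarrow> t \<in> S \<Longrightarrow>
    word_equiv W S (u @ concat (replicate (group.ord W (s \<otimes>\<^bsub>W\<^esub> t)) [s, t]) @ v) (u @ v)"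

text \<open>
  This is Bourbaki's definition: \<open>S\<close> consists of elements of order 2, generates \<open>W\<close>, and the
  relations above present \<open>W\<close>.
\<close>

locale coxeter_system = group W for W (structure) +
  fixes S :: "'a set"
  assumes gens_subset: "S \<subseteq> carrier W"
    and gens_order: "s \<in> S \<Longrightarrow> ord s = 2"
    and gens_generate: "generate W S = carrier W"
    and presentation:
      "\<lbrakk>u \<in> lists S; v \<in> lists S; word_eval W u = word_eval W v\<rbrakk> \<Longrightarrow> word_equiv W S u v"

definition len :: "('a, 'b) monoid_scheme \<Rightarrow> 'a set \<Rightarrow> 'a \<Rightarrow> nat" where
  "len W S w = (LEAST n. \<exists>ws \<in> lists S. length ws = n \<and> word_eval W ws = w)"

definition spherical :: "('a, 'b) monoid_scheme \<Rightarrow> 'a set \<Rightarrow> bool" where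
  "spherical W J \<longleftrightarrow> finite (generate W J)"


section \<open>Poincare series\<close>

text \<open>
  The coefficients are meaningful when \<open>X \<subseteq> carrier W\<close> and \<open>S\<close> is finite: then only finitely
  many elements of \<open>X\<close> have a given length.
\<close>

definition poincare :: "('a, 'b) monoid_scheme \<Rightarrow> 'a set \<Rightarrow> 'a set \<Rightarrow> int fps" where
  "poincare W S X = Abs_fps (\<lambda>n. int (card {x \<in> X. len W S x = n}))"

text \<open>
  An element of \<open>\<rat>(t)\<close> that has a power series expansion at \<open>0\<close> has no pole there, so it can be
  written with a denominator whose constant coefficient is nonzero. The quotient on the
  right-hand side is then the quotient in \<open>\<rat>[[t]]\<close>.
\<close>

definition rational_fps :: "int fps \<Rightarrow> bool" where
  "rational_fps F \<longleftrightarrow> (\<exists>p q :: rat poly. coeff q 0 \<noteq> 0 \<and>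
     Abs_fps (\<lambda>n. rat_of_int (fps_nth F n)) = fps_of_poly p / fps_of_poly q)"


section \<open>Sets of minimal double coset representatives\<close>

text \<open>\<open>double_reps W S S' J K\<close> is \<open>\<^sup>JW\<^sub>S\<^sub>'\<^sup>K\<close>.\<close>

definition double_reps ::
    "('a, 'b) monoid_scheme \<Rightarrow> 'a set \<Rightarrow> 'a set \<Rightarrow> 'a set \<Rightarrow> 'a set \<Rightarrow> 'a set" where
  "double_reps W S S' J K = {w \<in> generate W S'.
     (\<forall>s\<in>J. len W S (s \<otimes>\<^bsub>W\<^esub> w) > len W S w) \<and>
     (\<forall>s\<in>K. len W S (w \<otimes>\<^bsub>W\<^esub> s) > len W S w)}"

text \<open>\<open>conj_set W x A\<close> is \<open>x A x\<^sup>-\<^sup>1\<close>.\<close>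

definition conj_set :: "('a, 'b) monoid_scheme \<Rightarrow> 'a \<Rightarrow> 'a set \<Rightarrow> 'a set" where
  "conj_set W x A = (\<lambda>a. x \<otimes>\<^bsub>W\<^esub> a \<otimes>\<^bsub>W\<^esub> inv\<^bsub>W\<^esub> x) ` A"

text \<open>\<open>p_set W S S' Q J K\<close> is \<open>p\<close> with superscript \<open>S'\<close> and subscripts \<open>Q, J, K\<close>; likewise
  \<open>h_set W S S' R J K\<close>.\<close>

definition p_set ::
    "('a, 'b) monoid_scheme \<Rightarrow> 'a set \<Rightarrow> 'a set \<Rightarrow> 'a set \<Rightarrow> 'a set \<Rightarrow> 'a set \<Rightarrow> 'a set" where
  "p_set W S S' Q J K = {x \<in> double_reps W S S' J K. K \<inter> conj_set W (inv\<^bsub>W\<^esub> x) J = Q}"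

definition h_set ::
    "('a, 'b) monoid_scheme \<Rightarrow> 'a set \<Rightarrow> 'a set \<Rightarrow> 'a set \<Rightarrow> 'a set \<Rightarrow> 'a set \<Rightarrow> 'a set" where
  "h_set W S S' R J K = {x \<in> double_reps W S S' J K. conj_set W x K = R}"

end

theory Submission
  imports Defs
begin

text \<open>
  Write \<open>p(S';Q,J,K)\<close> and \<open>h(S';R,J,K)\<close> for the series in question. Everything except the passage
  from spherical to arbitrary subsets rests on one mechanism. For \<open>K \<subseteq> S'\<close> every element of \<open>W\<^sub>S\<^sub>'\<close>
  is uniquely \<open>x u\<close> with \<open>x\<close> minimal in \<open>x W\<^sub>K\<close> and \<open>u \<in> W\<^sub>K\<close>, and the lengths add. Deodhar's lemma
  (\<open>left_ascent_cases\<close>) says how left multiplication by a generator interacts with this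
  factorisation, and it follows that for \<open>K' \<subseteq> K \<subseteq> S'\<close> the product \<open>x u\<close> is \<open>(J, K')\<close>-minimal iff
  \<open>x\<close> is \<open>(J, K)\<close>-minimal and \<open>u\<close> is \<open>(Q, K')\<close>-minimal in \<open>W\<^sub>K\<close>, where \<open>Q = K \<inter> x\<^sup>-\<^sup>1 J x\<close>. Keeping track
  of the intersections gives, for \<open>K' \<subseteq> K\<close> and for \<open>R \<subseteq> J \<subseteq> J\<^sub>1\<close> respectively,

    \<open>p(S';Q',J,K') = (\<Sum>Q \<subseteq> K. p(S';Q,J,K) p(K;Q',Q,K'))\<close>  (\<open>poincare_p_set_refine\<close>),

    \<open>h(S';R,J,K) = (\<Sum>R\<^sub>1 \<subseteq> J\<^sub>1. h(S';R\<^sub>1,J\<^sub>1,K) h(J\<^sub>1;R,J,R\<^sub>1))\<close>  (\<open>poincare_h_set_refine\<close>).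

  These relations are used in two ways. If \<open>K\<close> (respectively \<open>J\<^sub>1\<close>) omits one element of \<open>S'\<close>, they
  express a series through those of conditions (ii) and (v) and series over a smaller generating
  set, so (ii) and (v) give (i) and (iv) by induction on \<open>|S'|\<close>. If instead \<open>Q' = K'\<close> (respectively
  \<open>J = R\<close>) runs over all subsets of \<open>K\<close> (of \<open>J\<^sub>1\<close>), they form a square linear system for the series
  over the larger set. Only the identity contributes to constant terms, so the constant terms
  of the matrix form a unitriangular matrix for inclusion, and a system with rational
  coefficients and rational right-hand side has a rational solution
  (\<open>rational_fps_linear_system\<close>). This yields (iii) \<open>\<Longrightarrow>\<close> (i) and (vi) \<open>\<Longrightarrow>\<close> (iv), while (iv) \<open>\<Longrightarrow>\<close> (iii)
  and the statement on the full sets of double coset representatives are finite sums over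
  disjoint unions.

  It remains to see that (vii) implies (vi). Let \<open>x K x\<^sup>-\<^sup>1 = J\<close> with \<open>x\<close> minimal and \<open>W\<^sub>K\<close> infinite. Then \<open>K\<close>
  has a connected component \<open>L\<close> with \<open>W\<^sub>L\<close> infinite, and \<open>conj_infinite_irreducible\<close>, again
  due to Deodhar, forces \<open>x\<close> to lie in the subgroup generated by the elements of \<open>S' - L\<close> that
  commute with \<open>L\<close>. So \<open>L\<close> may be removed from \<open>J\<close> and \<open>K\<close>, and \<open>S'\<close> be replaced by that set of
  elements, without changing the set of such \<open>x\<close>; this is repeated until \<open>K\<close> is spherical. The key point of \<open>conj_infinite_irreducible\<close> is the following.
  If \<open>I = L \<union> {s}\<close> is connected and \<open>v \<in> W\<^sub>I\<close>, \<open>v \<noteq> 1\<close>, is minimal in \<open>v W\<^sub>L\<close> with \<open>v L v\<^sup>-\<^sup>1 \<subseteq> I\<close>, then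
  \<open>W\<^sub>I\<close> is finite. Indeed \<open>v\<close> then behaves like the longest coset representative: every
  element of \<open>W\<^sub>I\<close> lies below some element of \<open>v W\<^sub>L\<close> in Bruhat order, so \<open>W\<^sub>L\<close> has finite index
  in \<open>W\<^sub>I\<close>; and since \<open>I\<close> is connected, a proper parabolic subgroup contains no nontrivial
  normal subgroup of \<open>W\<^sub>I\<close>, so \<open>W\<^sub>I\<close> embeds into a finite set of maps on cosets.

  The combinatorics of reduced words comes from the strong exchange condition, which is derived
  from the presentation through the parity of the number of times that a group element
  occurs among the reflections attached to the letters of a word.
\<close>

section \<open>Rational power series and unitriangular linear systems\<close>

unbundle fps_syntax

text \<open>
  Clearing the denominator avoids division of power series in the closure properties below.
\<close>

lemma rational_fps_iff:
  "rational_fps F \<longleftrightarrow> (\<exists>p q :: rat poly. coeff q 0 \<noteq> 0 \<and>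
     fps_of_poly q * Abs_fps (\<lambda>n. rat_of_int (fps_nth F n)) = fps_of_poly p)"
proof -
  have "Y = fps_of_poly p / fps_of_poly q \<longleftrightarrow> fps_of_poly q * Y = fps_of_poly p"
    if q: "coeff q 0 \<noteq> 0" for p q :: "rat poly" and Y
  proof -
    let ?q = "fps_of_poly q"
    have q0: "?q $ 0 \<noteq> 0" using q by simp
    have inv: "?q * inverse ?q = 1" using inverse_mult_eq_1'[OF q0] .
    have "?q * (fps_of_poly p * inverse ?q) = fps_of_poly p * (?q * inverse ?q)" by (simp only: ac_simps)
    moreover have "?q * Y * inverse ?q = Y * (?q * inverse ?q)" by (simp only: ac_simps)
    ultimately show ?thesis unfolding fps_divide_unit[OF q0] inv by (metis mult.right_neutral)
  qed
  thus ?thesis unfolding rational_fps_def by blast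
qed

lemma rat_fps_mult:
  "Abs_fps (\<lambda>n. rat_of_int ((F * G) $ n)) =
   Abs_fps (\<lambda>n. rat_of_int (F $ n)) * Abs_fps (\<lambda>n. rat_of_int (G $ n))"
  by (rule fps_ext) (simp add: fps_mult_nth)

lemma rat_fps_diff:
  "Abs_fps (\<lambda>n. rat_of_int ((F - G) $ n)) =
   Abs_fps (\<lambda>n. rat_of_int (F $ n)) - Abs_fps (\<lambda>n. rat_of_int (G $ n))"
  by (rule fps_ext) simp

lemma rational_fps_0 [simp]: "rational_fps 0"
  unfolding rational_fps_iff by (rule exI[of _ 0], rule exI[of _ 1]) (auto simp: fps_eq_iff)

lemma rational_fps_1 [simp]: "rational_fps 1"
  unfolding rational_fps_iff
  by (rule exI[of _ 1], rule exI[of _ 1]) (auto simp: fps_eq_iff)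

lemma rational_fps_mult:
  assumes "rational_fps F" "rational_fps G"
  shows "rational_fps (F * G)"
proof -
  let ?F = "Abs_fps (\<lambda>n. rat_of_int (F $ n))" and ?G = "Abs_fps (\<lambda>n. rat_of_int (G $ n))"
  obtain p q p' q' :: "rat poly" where
    *: "coeff q 0 \<noteq> 0" "fps_of_poly q * ?F = fps_of_poly p"
    "coeff q' 0 \<noteq> 0" "fps_of_poly q' * ?G = fps_of_poly p'"
    using assms unfolding rational_fps_iff by blast
  have "fps_of_poly (q * q') * (?F * ?G) = (fps_of_poly q * ?F) * (fps_of_poly q' * ?G)"
    by (simp add: fps_of_poly_mult)
  also have "\<dots> = fps_of_poly (p * p')"
    unfolding * by (simp add: fps_of_poly_mult)
  finally show ?thesis unfolding rational_fps_iff rat_fps_mult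
    using * by (intro exI[of _ "p * p'"] exI[of _ "q * q'"]) (auto simp: coeff_mult_0)
qed

lemma rational_fps_diff:
  assumes "rational_fps F" "rational_fps G"
  shows "rational_fps (F - G)"
proof -
  let ?F = "Abs_fps (\<lambda>n. rat_of_int (F $ n))" and ?G = "Abs_fps (\<lambda>n. rat_of_int (G $ n))"
  obtain p q p' q' :: "rat poly" where
    *: "coeff q 0 \<noteq> 0" "fps_of_poly q * ?F = fps_of_poly p"
    "coeff q' 0 \<noteq> 0" "fps_of_poly q' * ?G = fps_of_poly p'"
    using assms unfolding rational_fps_iff by blast
  have "fps_of_poly (q * q') * (?F - ?G) =
        fps_of_poly q' * (fps_of_poly q * ?F) - fps_of_poly q * (fps_of_poly q' * ?G)"
    by (simp add: fps_of_poly_mult algebra_simps)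
  also have "\<dots> = fps_of_poly (q' * p - q * p')"
    unfolding * by (simp add: fps_of_poly_mult fps_of_poly_diff)
  finally show ?thesis unfolding rational_fps_iff rat_fps_diff
    using * by (intro exI[of _ "q' * p - q * p'"] exI[of _ "q * q'"]) (auto simp: coeff_mult_0)
qed

lemma rational_fps_add:
  assumes "rational_fps F" "rational_fps G"
  shows "rational_fps (F + G)"
  using rational_fps_diff[OF assms(1) rational_fps_diff[OF rational_fps_0 assms(2)]] by simp

lemma rational_fps_sum: "(\<And>i. i \<in> A \<Longrightarrow> rational_fps (F i)) \<Longrightarrow> rational_fps (\<Sum>i\<in>A. F i)"
  by (induction A rule: infinite_finite_induct) (auto intro: rational_fps_add)

text \<open>
  Needed because no inverse of \<open>G\<close> is formed in \<open>\<int>[[t]]\<close>: the numerator of \<open>G\<close> has nonzero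
  constant term, so it may serve as part of a denominator for \<open>F\<close>.
\<close>

lemma rational_fps_cancel:
  assumes "rational_fps (G * F)" "rational_fps G" "G $ 0 \<noteq> 0"
  shows "rational_fps F"
proof -
  let ?F = "Abs_fps (\<lambda>n. rat_of_int (F $ n))" and ?G = "Abs_fps (\<lambda>n. rat_of_int (G $ n))"
  obtain p q p' q' :: "rat poly" where
    *: "coeff q 0 \<noteq> 0" "fps_of_poly q * (?G * ?F) = fps_of_poly p"
    "coeff q' 0 \<noteq> 0" "fps_of_poly q' * ?G = fps_of_poly p'"
    using assms unfolding rational_fps_iff rat_fps_mult by blast
  have "coeff p' 0 = (fps_of_poly q' * ?G) $ 0" unfolding * by simp
  also have "\<dots> \<noteq> 0" using *(3) assms(3) by simp
  finally have "coeff (q * p') 0 \<noteq> 0" using * by (simp add: coeff_mult_0)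
  moreover have "fps_of_poly (q * p') * ?F = fps_of_poly (q' * p)"
    unfolding fps_of_poly_mult *(2,4)[symmetric] by (simp only: ac_simps)
  ultimately show ?thesis unfolding rational_fps_iff by blast
qed

text \<open>
  The matrix of constant terms is unitriangular for the order of the index type, which is all
  that Gaussian elimination needs. Eliminating the variable \<open>x a\<close> replaces row \<open>c\<close> by
  \<open>M a a\<close> times row \<open>c\<close> minus \<open>M c a\<close> times row \<open>a\<close>. This stays in \<open>\<int>[[t]]\<close>, and the new constant
  terms are again unitriangular: off the diagonal by transitivity, and on the diagonal because
  \<open>M c a\<close> and \<open>M a c\<close> cannot both have nonzero constant term for \<open>a \<noteq> c\<close>.
\<close>

lemma rational_fps_linear_system:
  fixes M :: "'i::order \<Rightarrow> 'i \<Rightarrow> int fps"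
  assumes "finite A"
    and "\<And>a b. \<lbrakk>a \<in> A; b \<in> A\<rbrakk> \<Longrightarrow> rational_fps (M a b)"
    and "\<And>a. a \<in> A \<Longrightarrow> rational_fps (y a)"
    and "\<And>a. a \<in> A \<Longrightarrow> M a a $ 0 = 1"
    and "\<And>a b. \<lbrakk>a \<in> A; b \<in> A; M a b $ 0 \<noteq> 0\<rbrakk> \<Longrightarrow> a \<le> b"
    and "\<And>a. a \<in> A \<Longrightarrow> (\<Sum>b\<in>A. M a b * x b) = y a"
  shows "\<forall>a\<in>A. rational_fps (x a)"
  using assms
proof (induction A arbitrary: M y rule: finite_induct)
  case (insert a A)
  note M = insert.prems(1) and y = insert.prems(2) and diag = insert.prems(3)
    and tri = insert.prems(4) and eq = insert.prems(5)
  define M' where "M' c b = M a a * M c b - M c a * M a b" for c b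
  define y' where "y' c = M a a * y c - M c a * y a" for c
  have split: "M c a * x a + (\<Sum>b\<in>A. M c b * x b) = y c" if "c \<in> insert a A" for c
    using eq[OF that] insert.hyps by simp
  have "\<forall>c\<in>A. rational_fps (x c)"
  proof (rule insert.IH[of M' y'])
    fix c b assume cb: "c \<in> A" "b \<in> A"
    show "rational_fps (M' c b)" unfolding M'_def using M cb by (auto intro!: rational_fps_diff rational_fps_mult)
    show "c \<le> b" if "M' c b $ 0 \<noteq> 0"
    proof -
      have "M c b $ 0 \<noteq> 0 \<or> M c a $ 0 \<noteq> 0 \<and> M a b $ 0 \<noteq> 0"
        using that unfolding M'_def by auto
      thus ?thesis using tri cb by (metis insertCI order_trans)
    qed
  next
    fix c assume c: "c \<in> A"
    show "rational_fps (y' c)" unfolding y'_def using M y c by (auto intro!: rational_fps_diff rational_fps_mult)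
    have "M c a $ 0 = 0 \<or> M a c $ 0 = 0" using tri c insert.hyps by (metis insertCI order_antisym)
    thus "M' c c $ 0 = 1" unfolding M'_def using diag c by auto
    have "(\<Sum>b\<in>A. M' c b * x b) = M a a * (\<Sum>b\<in>A. M c b * x b) - M c a * (\<Sum>b\<in>A. M a b * x b)"
      unfolding M'_def by (simp add: algebra_simps sum_subtractf sum_distrib_left)
    also have "(\<Sum>b\<in>A. M c b * x b) = y c - M c a * x a" using split[of c] c by (simp add: algebra_simps)
    also have "(\<Sum>b\<in>A. M a b * x b) = y a - M a a * x a" using split[of a] by (simp add: algebra_simps)
    finally show "(\<Sum>b\<in>A. M' c b * x b) = y' c" unfolding y'_def by (simp add: algebra_simps)
  qed
  moreover have "rational_fps (x a)"
  proof (rule rational_fps_cancel)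
    have "M a a * x a = y a - (\<Sum>b\<in>A. M a b * x b)" using split[of a] by (simp add: algebra_simps)
    thus "rational_fps (M a a * x a)"
      using calculation M y by (auto intro!: rational_fps_diff rational_fps_sum rational_fps_mult)
  qed (use M diag in auto)
  ultimately show ?case by auto
qed simp

section \<open>Words, reflections and the exchange condition\<close>

text \<open>
  To a word \<open>s\<^sub>1 \<dots> s\<^sub>k\<close> belong the elements \<open>t\<^sub>i = s\<^sub>k \<dots> s\<^sub>i\<^sub>+\<^sub>1 s\<^sub>i s\<^sub>i\<^sub>+\<^sub>1 \<dots> s\<^sub>k\<close>. The predicate records whether \<open>t\<close>
  occurs an odd number of times among them. For a reflection \<open>t\<close> and the product \<open>w\<close> of the word
  this turns out to say that \<open>t\<close> is a right inversion of \<open>w\<close>.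
\<close>

primrec inversion_parity :: "('a, 'b) monoid_scheme \<Rightarrow> 'a list \<Rightarrow> 'a \<Rightarrow> bool" where
  "inversion_parity W [] t \<longleftrightarrow> False"
| "inversion_parity W (s # ws) t \<longleftrightarrow>
     (word_eval W ws \<otimes>\<^bsub>W\<^esub> t = s \<otimes>\<^bsub>W\<^esub> word_eval W ws) \<noteq> inversion_parity W ws t"

declare in_lists_conv_set [simp del]

context coxeter_system
begin

abbreviation ev :: "'a list \<Rightarrow> 'a" where "ev ws \<equiv> word_eval W ws"
abbreviation ell :: "'a \<Rightarrow> nat" where "ell w \<equiv> len W S w"
abbreviation gen :: "'a set \<Rightarrow> 'a set" where "gen K \<equiv> generate W K"
abbreviation par :: "'a list \<Rightarrow> 'a \<Rightarrow> bool" where "par \<equiv> inversion_parity W"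

lemma ev_Nil [simp]: "ev [] = \<one>"
  and ev_Cons [simp]: "ev (s # ws) = s \<otimes> ev ws"
  by (simp_all add: word_eval_def)

lemma gen_carrier [simp, intro]: "s \<in> S \<Longrightarrow> s \<in> carrier W"
  using gens_subset by auto

lemma ev_closed [simp, intro]: "ws \<in> lists S \<Longrightarrow> ev ws \<in> carrier W"
  by (induction ws) auto

lemma ev_append [simp]:
  "\<lbrakk>u \<in> lists S; v \<in> lists S\<rbrakk> \<Longrightarrow> ev (u @ v) = ev u \<otimes> ev v"
  by (induction u) (auto simp: m_assoc)

lemma gen_sq [simp]: "s \<in> S \<Longrightarrow> s \<otimes> s = \<one>"
  using gens_order[of s] pow_ord_eq_1[of s] by (simp add: numeral_2_eq_2)

lemma gen_inv [simp]: "s \<in> S \<Longrightarrow> inv s = s"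
  by (simp add: inv_equality)

lemma gen_neq_one: "s \<in> S \<Longrightarrow> s \<noteq> \<one>"
  using gens_order[of s] ord_eq_1[of s] by auto

lemma gen_cancel [simp]: "\<lbrakk>s \<in> S; x \<in> carrier W\<rbrakk> \<Longrightarrow> s \<otimes> (s \<otimes> x) = x"
  by (simp flip: m_assoc)

lemma inv_cancel [simp]:
  "\<lbrakk>x \<in> carrier W; y \<in> carrier W\<rbrakk> \<Longrightarrow> inv x \<otimes> (x \<otimes> y) = y"
  "\<lbrakk>x \<in> carrier W; y \<in> carrier W\<rbrakk> \<Longrightarrow> x \<otimes> (inv x \<otimes> y) = y"
  by (simp_all flip: m_assoc)

lemma rev_in_lists [simp]: "rev ws \<in> lists K \<longleftrightarrow> ws \<in> lists K"
  by (auto simp: in_lists_conv_set)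

lemma ev_rev: "ws \<in> lists S \<Longrightarrow> ev (rev ws) = inv (ev ws)"
  by (induction ws) (auto simp: inv_mult_group)

text \<open>
  The cocycle rule, by which the parity can be computed for products.
\<close>

lemma parity_append:
  "\<lbrakk>u \<in> lists S; v \<in> lists S; t \<in> carrier W\<rbrakk> \<Longrightarrow>
     par (u @ v) t \<longleftrightarrow> par u (ev v \<otimes> t \<otimes> inv (ev v)) \<noteq> par v t"
proof (induction u)
  case (Cons s u)
  have "ev (u @ v) \<otimes> t = s \<otimes> ev (u @ v) \<longleftrightarrow>
        (ev u \<otimes> (ev v \<otimes> t \<otimes> inv (ev v))) \<otimes> ev v = (s \<otimes> ev u) \<otimes> ev v"
    using Cons.prems by (simp add: m_assoc)
  also have "\<dots> \<longleftrightarrow> ev u \<otimes> (ev v \<otimes> t \<otimes> inv (ev v)) = s \<otimes> ev u"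
    using Cons.prems by (subst right_cancel) auto
  finally show ?case using Cons by auto
qed simp

lemma ev_replicate:
  "\<lbrakk>s \<in> S; t \<in> S\<rbrakk> \<Longrightarrow> ev (concat (replicate j [s, t])) = (s \<otimes> t) [^] j"
proof (induction j)
  case (Suc j)
  thus ?case using nat_pow_Suc2[of "s \<otimes> t" j] by (simp add: m_assoc)
qed simp

lemma replicate_in_lists:
  "\<lbrakk>s \<in> S; t \<in> S\<rbrakk> \<Longrightarrow> concat (replicate j [s, t]) \<in> lists S"
  by (induction j) auto

text \<open>
  The elements attached to the letters of \<open>(s t)\<^sup>j\<close> are \<open>(t s)\<^sup>i t\<close> for \<open>0 \<le> i < 2 j\<close>.
\<close>

lemma parity_braid_word:
  assumes "s \<in> S" "t \<in> S" "r \<in> carrier W"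
  shows "par (concat (replicate j [s, t])) r \<longleftrightarrow>
         odd (\<Sum>i<2*j. of_bool (r = (t \<otimes> s) [^] i \<otimes> t) :: nat)"
proof (induction j)
  case (Suc j)
  define d where "d = (t \<otimes> s) [^] j"
  define e where "e = (s \<otimes> t) [^] j"
  have cl [simp]: "s \<in> carrier W" "t \<in> carrier W" "d \<in> carrier W" "e \<in> carrier W"
    using assms by (auto simp: d_def e_def)
  have te: "t \<otimes> e = d \<otimes> t" unfolding d_def e_def
  proof (induction j)
    case (Suc j)
    have "t \<otimes> (s \<otimes> t) [^] Suc j = t \<otimes> (s \<otimes> t) [^] j \<otimes> (s \<otimes> t)"
      using assms by (simp add: m_assoc)
    also have "\<dots> = (t \<otimes> s) [^] j \<otimes> (t \<otimes> s) \<otimes> t" unfolding Suc using assms by (simp add: m_assoc)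
    finally show ?case by simp
  qed (use assms in simp)
  have "e \<otimes> d = \<one>"
  proof -
    have "inv (t \<otimes> s) = s \<otimes> t" using assms by (simp add: inv_mult_group)
    hence "e = inv d" using nat_pow_inv[of "t \<otimes> s" j] by (simp add: d_def e_def)
    thus ?thesis by simp
  qed
  hence de: "d \<otimes> e = \<one>" by (simp add: inv_comm)
  have dd: "(t \<otimes> s) [^] (2 * j) = d \<otimes> d" using nat_pow_mult[of "t \<otimes> s" j j] by (simp add: d_def mult_2)
  have 1: "e \<otimes> r = t \<otimes> e \<longleftrightarrow> r = (t \<otimes> s) [^] (2 * j) \<otimes> t"
  proof -
    have "e \<otimes> r = t \<otimes> e \<longleftrightarrow> d \<otimes> (e \<otimes> r) = d \<otimes> (d \<otimes> t)"
      using assms by (simp add: te)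
    also have "d \<otimes> (e \<otimes> r) = (d \<otimes> e) \<otimes> r" using assms by (simp add: m_assoc)
    also have "\<dots> = r" using assms de by simp
    finally show ?thesis by (simp add: dd m_assoc)
  qed
  have 2: "t \<otimes> e \<otimes> r = s \<otimes> (t \<otimes> e) \<longleftrightarrow> r = (t \<otimes> s) [^] (2 * j + 1) \<otimes> t"
  proof -
    have "t \<otimes> e \<otimes> r = s \<otimes> (t \<otimes> e) \<longleftrightarrow> d \<otimes> (t \<otimes> (t \<otimes> e \<otimes> r)) = d \<otimes> (t \<otimes> (s \<otimes> (t \<otimes> e)))"
      using assms by simp
    also have "d \<otimes> (t \<otimes> (t \<otimes> e \<otimes> r)) = (d \<otimes> e) \<otimes> r"
      using assms by (simp add: m_assoc)
    also have "\<dots> = r" using assms de by simp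
    also have "d \<otimes> (t \<otimes> (s \<otimes> (t \<otimes> e))) = d \<otimes> (t \<otimes> s) \<otimes> d \<otimes> t" by (simp add: te m_assoc)
    also have "d \<otimes> (t \<otimes> s) \<otimes> d = (t \<otimes> s) [^] (2 * j + 1)"
    proof -
      have "d \<otimes> (t \<otimes> s) = (t \<otimes> s) [^] Suc j" by (simp add: d_def)
      thus ?thesis using nat_pow_mult[of "t \<otimes> s" "Suc j" j] by (simp add: d_def mult_2 del: nat_pow_Suc)
    qed
    finally show ?thesis .
  qed
  have "par (concat (replicate (Suc j) [s, t])) r \<longleftrightarrow>
        (t \<otimes> e \<otimes> r = s \<otimes> (t \<otimes> e)) \<noteq> ((e \<otimes> r = t \<otimes> e) \<noteq> par (concat (replicate j [s, t])) r)"
    using assms by (simp add: ev_replicate e_def)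
  also have "\<dots> \<longleftrightarrow> odd (\<Sum>i<2*Suc j. of_bool (r = (t \<otimes> s) [^] i \<otimes> t) :: nat)"
  proof -
    have "2 * Suc j = Suc (Suc (2 * j))" by simp
    moreover have "even (of_bool b :: nat) \<longleftrightarrow> \<not> b" for b by simp
    ultimately show ?thesis unfolding 1 2 Suc Suc_eq_plus1[symmetric]
      by (simp only: sum.lessThan_Suc even_add) blast
  qed
  finally show ?case .
qed simp

text \<open>
  For \<open>m\<close> the order of \<open>s t\<close>, the list \<open>(t s)\<^sup>i t\<close>, \<open>i < 2 m\<close>, runs twice through its first half.
\<close>

lemma parity_relator:
  assumes "s \<in> S" "t \<in> S" "r \<in> carrier W"
  shows "\<not> par (concat (replicate (ord (s \<otimes> t)) [s, t])) r"
proof -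
  define m where "m = ord (s \<otimes> t)"
  define f where "f i = (of_bool (r = (t \<otimes> s) [^] i \<otimes> t) :: nat)" for i :: nat
  have "inv (s \<otimes> t) = t \<otimes> s" using assms by (simp add: inv_mult_group)
  hence "(t \<otimes> s) [^] m = inv ((s \<otimes> t) [^] m)"
    using assms nat_pow_inv[of "s \<otimes> t" m] by simp
  hence "(t \<otimes> s) [^] m = \<one>" using assms by (simp add: m_def pow_ord_eq_1)
  hence f: "f (i + m) = f i" for i
    using assms unfolding f_def by (simp flip: nat_pow_mult)
  have "(\<Sum>i<2*m. f i) = (\<Sum>i<m. f i) + (\<Sum>i=m..<m+m. f i)"
    by (simp add: mult_2 lessThan_atLeast0 sum.atLeastLessThan_concat)
  also have "(\<Sum>i=m..<m+m. f i) = (\<Sum>i<m. f (i + m))"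
    using sum.shift_bounds_nat_ivl[of f 0 m m] by (simp add: lessThan_atLeast0)
  finally have "even (\<Sum>i<2*m. f i)" by (simp add: f)
  thus ?thesis using parity_braid_word[OF assms, of m] unfolding m_def f_def by blast
qed

lemma word_equiv_parity:
  assumes "word_equiv W S u v"
  shows "u \<in> lists S \<and> v \<in> lists S \<and> ev u = ev v \<and> (\<forall>t\<in>carrier W. par u t = par v t)"
  using assms
proof (induction rule: word_equiv.induct)
  case (relator u v s t)
  let ?R = "concat (replicate (ord (s \<otimes> t)) [s, t])"
  have R: "?R \<in> lists S" "ev ?R = \<one>"
    using relator by (auto simp: replicate_in_lists ev_replicate pow_ord_eq_1)
  thus ?case using relator parity_relator[of s t]
    by (auto simp: parity_append)
qed auto

text \<open>
  Relators have trivial parity, so by the presentation the parity depends only on the element that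
  a word represents.
\<close>

lemma parity_cong:
  "\<lbrakk>u \<in> lists S; v \<in> lists S; ev u = ev v; t \<in> carrier W\<rbrakk> \<Longrightarrow> par u t = par v t"
  using presentation word_equiv_parity by blast

lemma gen_subgroup: "K \<subseteq> S \<Longrightarrow> subgroup (gen K) W"
  using gens_subset by (intro generate_is_subgroup) auto

lemma gen_in_carrier: "\<lbrakk>K \<subseteq> S; g \<in> gen K\<rbrakk> \<Longrightarrow> g \<in> carrier W"
  using subgroup.mem_carrier[OF gen_subgroup] by blast

lemma gen_closed:
  assumes "K \<subseteq> S"
  shows "\<one> \<in> gen K" "\<lbrakk>g \<in> gen K; h \<in> gen K\<rbrakk> \<Longrightarrow> g \<otimes> h \<in> gen K"
    "g \<in> gen K \<Longrightarrow> inv g \<in> gen K" "k \<in> K \<Longrightarrow> k \<in> gen K"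
  using subgroup.one_closed[OF gen_subgroup[OF assms]]
    subgroup.m_closed[OF gen_subgroup[OF assms]]
    subgroup.m_inv_closed[OF gen_subgroup[OF assms]] generate.incl
  by auto

lemma gen_mono: "K \<subseteq> L \<Longrightarrow> gen K \<subseteq> gen L"
  by (rule mono_generate)

lemma ev_in_gen: "\<lbrakk>K \<subseteq> S; ws \<in> lists K\<rbrakk> \<Longrightarrow> ev ws \<in> gen K"
  by (induction ws) (auto intro: gen_closed)

lemma gen_word:
  assumes "K \<subseteq> S" "w \<in> gen K"
  shows "\<exists>ws \<in> lists K. ev ws = w"
  using assms(2)
proof (induction rule: generate.induct)
  case one
  thus ?case by (intro bexI[of _ "[]"]) auto
next
  case (incl h)
  thus ?case using assms(1) by (intro bexI[of _ "[h]"]) auto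
next
  case (inv h)
  hence "h \<in> S" using assms(1) by auto
  thus ?case using inv by (intro bexI[of _ "[h]"]) auto
next
  case (eng h1 h2)
  then obtain w1 w2 where "w1 \<in> lists K" "w2 \<in> lists K" "ev w1 = h1" "ev w2 = h2" by auto
  moreover from this have "w1 \<in> lists S" "w2 \<in> lists S" using assms(1) lists_mono by blast+
  ultimately show ?case by (intro bexI[of _ "w1 @ w2"]) auto
qed

lemma len_word_le: "ws \<in> lists S \<Longrightarrow> ell (ev ws) \<le> length ws"
  unfolding len_def by (rule Least_le) auto

lemma ex_reduced_word:
  assumes "w \<in> carrier W"
  shows "\<exists>ws \<in> lists S. ev ws = w \<and> length ws = ell w"
proof -
  obtain ws where "ws \<in> lists S" "ev ws = w"
    using gen_word[of S w] assms gens_generate by auto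
  hence "\<exists>n. \<exists>ws \<in> lists S. length ws = n \<and> ev ws = w" by auto
  from LeastI_ex[OF this] show ?thesis unfolding len_def by auto
qed

lemma len_one [simp]: "ell \<one> = 0"
  using len_word_le[of "[]"] by simp

lemma len_eq_0: "w \<in> carrier W \<Longrightarrow> ell w = 0 \<longleftrightarrow> w = \<one>"
  using ex_reduced_word[of w] by force

lemma len_mult_le:
  assumes "x \<in> carrier W" "y \<in> carrier W"
  shows "ell (x \<otimes> y) \<le> ell x + ell y"
proof -
  obtain u v where "u \<in> lists S" "v \<in> lists S" "ev u = x" "ev v = y" "length u = ell x" "length v = ell y"
    using ex_reduced_word assms by meson
  thus ?thesis using len_word_le[of "u @ v"] by auto
qed

lemma len_gen: "s \<in> S \<Longrightarrow> ell s = 1"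
  using len_word_le[of "[s]"] len_eq_0[of s] gen_neq_one[of s] by auto

lemma len_inv [simp]: "w \<in> carrier W \<Longrightarrow> ell (inv w) = ell w"
proof -
  have le: "ell (inv w) \<le> ell w" if "w \<in> carrier W" for w
  proof -
    obtain ws where "ws \<in> lists S" "ev ws = w" "length ws = ell w"
      using ex_reduced_word \<open>w \<in> carrier W\<close> by blast
    thus ?thesis using len_word_le[of "rev ws"] by (simp add: ev_rev)
  qed
  show "ell (inv w) = ell w" if "w \<in> carrier W"
    using le[of w] le[of "inv w"] that by simp
qed

definition reflection :: "'a \<Rightarrow> bool" where
  "reflection t \<longleftrightarrow> (\<exists>u \<in> carrier W. \<exists>s \<in> S. t = u \<otimes> s \<otimes> inv u)"

lemma reflection_gen: "s \<in> S \<Longrightarrow> reflection s"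
  unfolding reflection_def by (rule bexI[of _ \<one>]) auto

lemma reflectionD: "reflection t \<Longrightarrow> t \<in> carrier W \<and> t \<otimes> t = \<one>"
  unfolding reflection_def by (auto simp: m_assoc)

lemma reflection_conj:
  assumes "reflection t" "x \<in> carrier W"
  shows "reflection (x \<otimes> t \<otimes> inv x)"
proof -
  obtain u s where "u \<in> carrier W" "s \<in> S" "t = u \<otimes> s \<otimes> inv u"
    using assms by (auto simp: reflection_def)
  hence "x \<otimes> t \<otimes> inv x = (x \<otimes> u) \<otimes> s \<otimes> inv (x \<otimes> u)"
    using assms by (simp add: inv_mult_group m_assoc)
  thus ?thesis using \<open>u \<in> carrier W\<close> \<open>s \<in> S\<close> assms unfolding reflection_def by (meson m_closed)
qed

text \<open>
  In the palindromic word \<open>u s u\<^sup>-\<^sup>1\<close> the contributions of the two outer parts cancel, because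
  \<open>u u\<^sup>-\<^sup>1\<close> represents the identity and so has even parity; the middle letter contributes once.
\<close>

lemma reflection_word:
  assumes "reflection t"
  shows "\<exists>ts \<in> lists S. ev ts = t \<and> par ts t"
proof -
  obtain x s where x: "x \<in> carrier W" "s \<in> S" "t = x \<otimes> s \<otimes> inv x"
    using assms by (auto simp: reflection_def)
  obtain u where u: "u \<in> lists S" "ev u = x" using ex_reduced_word x by blast
  have t: "t \<in> carrier W" using x by auto
  have xt: "inv x \<otimes> t \<otimes> x = s" using x by (simp add: m_assoc)
  have 1: "par (u @ rev u) t \<longleftrightarrow> par u s \<noteq> par (rev u) t"
    using u x t xt by (subst parity_append) (auto simp: ev_rev)
  have "\<not> par (u @ rev u) t"
    using parity_cong[of "u @ rev u" "[]" t] u x t by (simp add: ev_rev)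
  hence 2: "par u s \<longleftrightarrow> par (rev u) t" using 1 by blast
  have "par (u @ [s] @ rev u) t \<longleftrightarrow> par u (s \<otimes> s \<otimes> inv s) \<noteq> ((s = s) \<noteq> par (rev u) t)"
  proof -
    have "(s \<otimes> inv x) \<otimes> t \<otimes> inv (s \<otimes> inv x) = s \<otimes> (inv x \<otimes> t \<otimes> x) \<otimes> inv s"
      using x t by (simp add: m_assoc inv_mult_group)
    moreover have "inv x \<otimes> t = s \<otimes> inv x" using x by (simp add: m_assoc)
    ultimately show ?thesis
      using u x t xt by (subst parity_append) (auto simp: ev_rev)
  qed
  hence "par (u @ [s] @ rev u) t" using 2 x by (simp add: m_assoc)
  moreover have "ev (u @ [s] @ rev u) = t" using u x by (simp add: ev_rev m_assoc)
  ultimately show ?thesis using u x by (intro bexI[of _ "u @ [s] @ rev u"]) auto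
qed

text \<open>
  An odd parity means that \<open>t\<close> is attached to some letter of the word, and multiplying by \<open>t\<close>
  from the right cancels that letter.
\<close>

lemma parity_deletion:
  "\<lbrakk>ws \<in> lists S; t \<in> carrier W; par ws t\<rbrakk> \<Longrightarrow>
     \<exists>us s vs. ws = us @ s # vs \<and> ev ws \<otimes> t = ev (us @ vs)"
proof (induction ws)
  case (Cons s ws)
  show ?case
  proof (cases "par ws t")
    case True
    then obtain us r vs where "ws = us @ r # vs" "ev ws \<otimes> t = ev (us @ vs)"
      using Cons by auto
    thus ?thesis using Cons.prems by (intro exI[of _ "s # us"] exI[of _ r] exI[of _ vs]) (auto simp: m_assoc)
  next
    case False
    hence "ev ws \<otimes> t = s \<otimes> ev ws" using Cons.prems by simp
    thus ?thesis using Cons.prems by (intro exI[of _ "[]"] exI[of _ s] exI[of _ ws]) (auto simp: m_assoc)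
  qed
qed simp

lemma parity_len_less:
  assumes "ws \<in> lists S" "t \<in> carrier W" "par ws t"
  shows "ell (ev ws \<otimes> t) < ell (ev ws)"
proof -
  obtain u where u: "u \<in> lists S" "ev u = ev ws" "length u = ell (ev ws)"
    using ex_reduced_word assms by (meson ev_closed)
  hence "par u t" using parity_cong assms by blast
  then obtain us s vs where "u = us @ s # vs" "ev u \<otimes> t = ev (us @ vs)"
    using parity_deletion u assms by blast
  thus ?thesis using u len_word_le[of "us @ vs"] by auto
qed

text \<open>
  If the parity of \<open>w\<close> at \<open>t\<close> is even then that of \<open>w t\<close> is odd by the cocycle rule, so passing from
  \<open>w t\<close> back to \<open>w\<close> shortens. Hence exactly one of \<open>w\<close> and \<open>w t\<close> is the shorter one.
\<close>

lemma len_reflection_iff: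
  assumes "ws \<in> lists S" "reflection t"
  shows "ell (ev ws \<otimes> t) < ell (ev ws) \<longleftrightarrow> par ws t"
    and "ell (ev ws \<otimes> t) \<noteq> ell (ev ws)"
proof -
  have t: "t \<in> carrier W" "t \<otimes> t = \<one>" using reflectionD assms by auto
  obtain ts where ts: "ts \<in> lists S" "ev ts = t" "par ts t" using reflection_word assms by blast
  have *: "ell (ev ws) < ell (ev ws \<otimes> t)" if "\<not> par ws t"
  proof -
    have "t \<otimes> t \<otimes> inv t = t" using t by (metis inv_equality l_one)
    hence "par (ws @ ts) t" using that ts assms t by (subst parity_append) auto
    from parity_len_less[OF _ _ this] show ?thesis using ts assms t by (simp add: m_assoc)
  qed
  show "ell (ev ws \<otimes> t) < ell (ev ws) \<longleftrightarrow> par ws t"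
    using * parity_len_less[OF assms(1) t(1)] by fastforce
  show "ell (ev ws \<otimes> t) \<noteq> ell (ev ws)"
    using * parity_len_less[OF assms(1) t(1)] by fastforce
qed

lemma strong_exchange:
  assumes "ws \<in> lists S" "reflection t" "ell (ev ws \<otimes> t) < ell (ev ws)"
  obtains us s vs where "ws = us @ s # vs" "ev ws \<otimes> t = ev (us @ vs)"
  using parity_deletion len_reflection_iff(1) reflectionD assms by blast

lemma len_reflection_neq: "\<lbrakk>w \<in> carrier W; reflection t\<rbrakk> \<Longrightarrow> ell (w \<otimes> t) \<noteq> ell w"
  using len_reflection_iff(2) ex_reduced_word by blast

lemma len_mult_gen:
  assumes "w \<in> carrier W" "s \<in> S"
  shows "ell (w \<otimes> s) = ell w + 1 \<or> ell w = ell (w \<otimes> s) + 1"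
proof -
  have "ell (w \<otimes> s \<otimes> s) \<le> ell (w \<otimes> s) + 1" "ell (w \<otimes> s) \<le> ell w + 1"
    using len_mult_le[of "w \<otimes> s" s] len_mult_le[of w s] assms len_gen by auto
  moreover have "w \<otimes> s \<otimes> s = w" using assms by (simp add: m_assoc)
  ultimately show ?thesis using len_reflection_neq[OF assms(1) reflection_gen[OF assms(2)]] by auto
qed

lemma len_gen_mult:
  assumes "w \<in> carrier W" "s \<in> S"
  shows "ell (s \<otimes> w) = ell w + 1 \<or> ell w = ell (s \<otimes> w) + 1"
proof -
  have "ell (s \<otimes> w) = ell (inv w \<otimes> s)"
    using len_inv[of "s \<otimes> w"] assms by (simp add: inv_mult_group)
  thus ?thesis using len_mult_gen[of "inv w" s] assms by simp
qed

section \<open>Parabolic subgroups and minimal coset representatives\<close>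

lemma lists_subset: "\<lbrakk>K \<subseteq> L; ws \<in> lists K\<rbrakk> \<Longrightarrow> ws \<in> lists L"
  using lists_mono by blast

text \<open>
  Reducing a word by exchange only deletes letters, so an element of \<open>W\<^sub>K\<close> has a word of minimal
  length over \<open>S\<close> whose letters all lie in \<open>K\<close>.
\<close>

lemma ex_reduced_word_gen:
  assumes K: "K \<subseteq> S" and w: "w \<in> gen K"
  shows "\<exists>ws \<in> lists K. ev ws = w \<and> length ws = ell w"
proof -
  have "\<exists>us \<in> lists K. ev us = ev ws \<and> length us = ell (ev ws)" if "ws \<in> lists K" for ws
    using that
  proof (induction ws rule: rev_induct)
    case Nil
    show ?case by (intro bexI[of _ "[]"]) auto
  next
    case (snoc s ws)
    then obtain u where u: "u \<in> lists K" "ev u = ev ws" "length u = ell (ev ws)" by auto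
    have S: "s \<in> S" "s \<in> K" "u \<in> lists S" "ws \<in> lists S"
      using snoc.prems u K lists_subset by auto
    have e: "ev (ws @ [s]) = ev u \<otimes> s" using S u by simp
    consider "ell (ev u \<otimes> s) = ell (ev u) + 1" | "ell (ev u) = ell (ev u \<otimes> s) + 1"
      using len_mult_gen S by blast
    thus ?case
    proof cases
      case 1
      thus ?thesis using u S e by (intro bexI[of _ "u @ [s]"]) auto
    next
      case 2
      then obtain as r bs where d: "u = as @ r # bs" "ev u \<otimes> s = ev (as @ bs)"
        using strong_exchange[of u s] S reflection_gen by auto
      thus ?thesis using u e 2 by (intro bexI[of _ "as @ bs"]) auto
    qed
  qed
  thus ?thesis using gen_word[OF assms] by blast
qed

lemma gen_len_one: "\<lbrakk>K \<subseteq> S; g \<in> gen K; ell g = 1\<rbrakk> \<Longrightarrow> g \<in> K"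
  using ex_reduced_word_gen[of K g] gens_subset by (force simp: length_Suc_conv)

lemma ex_right_descent:
  assumes "K \<subseteq> S" "w \<in> gen K" "w \<noteq> \<one>"
  shows "\<exists>k\<in>K. ell w = ell (w \<otimes> k) + 1 \<and> w \<otimes> k \<in> gen K"
proof -
  obtain ws where ws: "ws \<in> lists K" "ev ws = w" "length ws = ell w"
    using ex_reduced_word_gen assms by blast
  then obtain us k where us: "ws = us @ [k]" using assms by (cases ws rule: rev_cases) auto
  have S: "us \<in> lists S" "k \<in> S" "us \<in> lists K" "k \<in> K"
    using us ws assms lists_subset by auto
  have "w = ev us \<otimes> k" using us ws S by simp
  hence "w \<otimes> k = ev us" using S by (simp add: m_assoc)
  moreover have "ell (ev us) \<le> length us" using len_word_le S by auto
  moreover have "ell w \<le> ell (w \<otimes> k) + 1"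
    using len_mult_gen[of w k] S assms gen_in_carrier by fastforce
  ultimately show ?thesis using ws us S ev_in_gen assms by (intro bexI[of _ k]) auto
qed

lemma ex_left_descent:
  assumes "K \<subseteq> S" "w \<in> gen K" "w \<noteq> \<one>"
  shows "\<exists>k\<in>K. ell w = ell (k \<otimes> w) + 1"
proof -
  have w: "w \<in> carrier W" using assms gen_in_carrier by blast
  have "inv w \<noteq> \<one>" using assms w by (metis inv_inv inv_one)
  then obtain k where k: "k \<in> K" "ell (inv w) = ell (inv w \<otimes> k) + 1"
    using ex_right_descent[of K "inv w"] assms gen_closed by blast
  have "inv (inv w \<otimes> k) = k \<otimes> w" using w k assms by (auto simp: inv_mult_group)
  thus ?thesis using len_inv[of "inv w \<otimes> k"] k w assms by (auto intro!: bexI[of _ k])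
qed

text \<open>
  This is \<open>W\<^sup>K\<close>. The local condition on right multiplication by single generators is equivalent to
  minimality in the coset \<open>x W\<^sub>K\<close>, see \<open>min_right_minimal\<close> below.
\<close>

definition min_right :: "'a set \<Rightarrow> 'a set" where
  "min_right K = {x \<in> carrier W. \<forall>k\<in>K. ell x < ell (x \<otimes> k)}"

lemma append_eq_middle:
  "xs @ ws = us @ s # vs \<Longrightarrow>
    (\<exists>vs'. xs = us @ s # vs' \<and> vs = vs' @ ws) \<or> (\<exists>us'. ws = us' @ s # vs \<and> us = xs @ us')"
  by (auto simp: append_eq_append_conv2 append_eq_Cons_conv Cons_eq_append_conv)

text \<open>
  If appending a letter \<open>k\<close> to a reduced word of \<open>x u\<close> made it shorter, the exchange condition would
  delete a letter either from \<open>u\<close>, contradicting that \<open>u k\<close> is reduced, or from \<open>x\<close>, giving a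
  shorter element of the coset \<open>x W\<^sub>K\<close>.
\<close>

lemma coset_min_len_add:
  assumes K: "K \<subseteq> S" and x: "x \<in> carrier W" and min: "\<And>g. g \<in> gen K \<Longrightarrow> ell x \<le> ell (x \<otimes> g)"
    and u: "u \<in> gen K"
  shows "ell (x \<otimes> u) = ell x + ell u"
proof -
  have "ell (x \<otimes> ev ws) = ell x + length ws" if "ws \<in> lists K" "length ws = ell (ev ws)" for ws
    using that
  proof (induction ws rule: rev_induct)
    case (snoc k ws)
    have k: "k \<in> K" "ws \<in> lists K" using snoc by auto
    have S: "ws \<in> lists S" "k \<in> S" using k K lists_subset by auto
    have ewk: "ev (ws @ [k]) = ev ws \<otimes> k" using S by simp
    have "ell (ev ws \<otimes> k) \<le> ell (ev ws) + 1" using len_mult_gen[of "ev ws" k] S by fastforce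
    hence red: "length ws = ell (ev ws)" using snoc.prems ewk len_word_le[of ws] S by simp
    hence IH: "ell (x \<otimes> ev ws) = ell x + length ws" using snoc.IH k by blast
    \<comment> \<open>right multiplication by the generator k changes the length by one, so it suffices to exclude a decrease\<close>
    have "\<not> ell (x \<otimes> ev ws \<otimes> k) < ell (x \<otimes> ev ws)"
    proof
      assume less: "ell (x \<otimes> ev ws \<otimes> k) < ell (x \<otimes> ev ws)"
      obtain xs where xs: "xs \<in> lists S" "ev xs = x" "length xs = ell x"
        using ex_reduced_word x by blast
      have e: "ev (xs @ ws) = x \<otimes> ev ws" using xs S by simp
      obtain us s vs where d: "xs @ ws = us @ s # vs" "ev (xs @ ws) \<otimes> k = ev (us @ vs)"
        using strong_exchange[of "xs @ ws" k] reflection_gen S xs less e by auto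
      from append_eq_middle[OF d(1)] show False
      proof (elim disjE exE conjE)
        fix vs' assume *: "xs = us @ s # vs'" "vs = vs' @ ws"
        have in': "us \<in> lists S" "vs' \<in> lists S" using * xs by auto
        have "x \<otimes> (ev ws \<otimes> k \<otimes> inv (ev ws)) = (x \<otimes> ev ws \<otimes> k) \<otimes> inv (ev ws)"
          using x S by (simp add: m_assoc)
        also have "\<dots> = ev (us @ vs')" using d(2) e * in' S by (simp add: m_assoc)
        finally have "ell (x \<otimes> (ev ws \<otimes> k \<otimes> inv (ev ws))) \<le> length (us @ vs')"
          using len_word_le[of "us @ vs'"] in' by simp
        moreover have "ev ws \<otimes> k \<otimes> inv (ev ws) \<in> gen K"
          using ev_in_gen[OF K k(2)] gen_closed[OF K] k(1) by blast
        ultimately show False using min xs * by fastforce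
      next
        fix us' assume *: "ws = us' @ s # vs" "us = xs @ us'"
        have in': "us' \<in> lists S" "vs \<in> lists S" using * S by auto
        have "x \<otimes> (ev ws \<otimes> k) = x \<otimes> ev (us' @ vs)"
          using d(2) e * in' S x xs by (simp add: m_assoc)
        hence "ev ws \<otimes> k = ev (us' @ vs)"
          using x S in' by (simp del: ev_append)
        hence "ell (ev (ws @ [k])) \<le> length (us' @ vs)"
          using ewk len_word_le[of "us' @ vs"] in' by simp
        thus False using snoc.prems * by simp
      qed
    qed
    hence "ell (x \<otimes> ev ws \<otimes> k) = ell (x \<otimes> ev ws) + 1"
      using len_mult_gen[of "x \<otimes> ev ws" k] x S by auto
    thus ?case using IH x S by (simp add: m_assoc)
  qed (use x in simp)
  thus ?thesis using ex_reduced_word_gen[OF K u] by auto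
qed

text \<open>
  Compare \<open>x\<close> with a shortest element \<open>m\<close> of its coset: \<open>x = m u\<close> with \<open>\<ell>(x) = \<ell>(m) + \<ell>(u)\<close>, so a right
  descent of \<open>u\<close> would be one of \<open>x\<close>.
\<close>

lemma min_right_minimal:
  assumes K: "K \<subseteq> S" and x: "x \<in> min_right K" and g: "g \<in> gen K"
  shows "ell x \<le> ell (x \<otimes> g)"
proof -
  have xc: "x \<in> carrier W" using x by (simp add: min_right_def)
  define h where "h = arg_min (\<lambda>h. ell (x \<otimes> h)) (\<lambda>h. h \<in> gen K)"
  have h: "h \<in> gen K" "\<And>g. g \<in> gen K \<Longrightarrow> ell (x \<otimes> h) \<le> ell (x \<otimes> g)"
    using arg_min_nat_lemma[of "\<lambda>h. h \<in> gen K" \<one> "\<lambda>h. ell (x \<otimes> h)"] gen_closed[OF K]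
    unfolding h_def by auto
  define m where "m = x \<otimes> h"
  have hc: "h \<in> carrier W" and m: "m \<in> carrier W" using gen_in_carrier[OF K h(1)] xc by (auto simp: m_def)
  have min: "ell m \<le> ell (m \<otimes> g)" if "g \<in> gen K" for g
    using h(2)[OF gen_closed(2)[OF K h(1) that]] gen_in_carrier[OF K that] xc hc
    by (simp add: m_def m_assoc)
  have add: "ell (m \<otimes> u) = ell m + ell u" if "u \<in> gen K" for u
    using coset_min_len_add[OF K m min that] .
  have xm: "x = m \<otimes> inv h" using xc hc by (simp add: m_def m_assoc)
  have "inv h = \<one>"
  proof (rule ccontr)
    assume "inv h \<noteq> \<one>"
    then obtain k where k: "k \<in> K" "ell (inv h) = ell (inv h \<otimes> k) + 1" "inv h \<otimes> k \<in> gen K"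
      using ex_right_descent[OF K gen_closed(3)[OF K h(1)]] by blast
    have "k \<in> carrier W" using k K by auto
    hence "m \<otimes> inv h \<otimes> k = m \<otimes> (inv h \<otimes> k)" using m hc by (simp add: m_assoc)
    moreover have "ell (m \<otimes> (inv h \<otimes> k)) < ell (m \<otimes> inv h)"
      using add[OF k(3)] add[OF gen_closed(3)[OF K h(1)]] k(2) by linarith
    ultimately have "ell (x \<otimes> k) < ell x" using xm by metis
    thus False using x k by (auto simp: min_right_def)
  qed
  hence "m = x" using xm m by simp
  thus ?thesis using min[OF g] by simp
qed

lemma min_right_len_add:
  "\<lbrakk>K \<subseteq> S; x \<in> min_right K; u \<in> gen K\<rbrakk> \<Longrightarrow> ell (x \<otimes> u) = ell x + ell u"
  using coset_min_len_add[of K x u] min_right_minimal[of K x] by (auto simp: min_right_def)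

lemma min_right_unique:
  assumes K: "K \<subseteq> S" and "x \<in> min_right K" "y \<in> min_right K" "u \<in> gen K" "v \<in> gen K"
    and eq: "x \<otimes> u = y \<otimes> v"
  shows "x = y \<and> u = v"
proof -
  have c [simp]: "x \<in> carrier W" "y \<in> carrier W" "u \<in> carrier W" "v \<in> carrier W"
    using assms gen_in_carrier by (auto simp: min_right_def)
  define g where "g = v \<otimes> inv u"
  have g: "g \<in> gen K" "g \<in> carrier W" using assms gen_closed by (auto simp: g_def)
  have x: "x = y \<otimes> g" using eq by (simp add: g_def flip: m_assoc) (simp add: m_assoc flip: eq)
  hence y: "y = x \<otimes> inv g" using g by (simp add: m_assoc)
  have "ell x = ell y + ell g" using x min_right_len_add[OF K assms(3) g(1)] by simp
  moreover have "ell y = ell x + ell (inv g)"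
    using min_right_len_add[OF K assms(2) gen_closed(3)[OF K g(1)]] unfolding y[symmetric] .
  ultimately have "g = \<one>" using g len_eq_0 by auto
  hence "x = y" using x by simp
  thus ?thesis using eq by simp
qed

lemma min_right_decomp:
  assumes "K \<subseteq> L" "L \<subseteq> S" "w \<in> gen L"
  shows "\<exists>x \<in> gen L \<inter> min_right K. \<exists>u \<in> gen K. w = x \<otimes> u"
  using assms(3)
proof (induction "ell w" arbitrary: w rule: less_induct)
  case less
  have K: "K \<subseteq> S" using assms by auto
  have wc: "w \<in> carrier W" using less gen_in_carrier assms by blast
  show ?case
  proof (cases "w \<in> min_right K")
    case True
    thus ?thesis using less wc gen_closed[OF K] by (intro bexI[of _ w] bexI[of _ \<one>]) auto
  next
    case False
    then obtain k where k: "k \<in> K" "\<not> ell w < ell (w \<otimes> k)" using wc by (auto simp: min_right_def)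
    have kS: "k \<in> S" "k \<in> gen K" "k \<in> gen L" using k K assms by (auto intro: generate.incl)
    have "ell (w \<otimes> k) < ell w" using len_mult_gen[OF wc kS(1)] k by auto
    moreover have "w \<otimes> k \<in> gen L" using less kS gen_closed assms by auto
    ultimately obtain x u where *: "x \<in> gen L \<inter> min_right K" "u \<in> gen K" "w \<otimes> k = x \<otimes> u"
      using less.hyps by blast
    hence "w \<otimes> k \<otimes> k = x \<otimes> u \<otimes> k" by simp
    moreover have "u \<in> carrier W" "x \<in> carrier W" using * gen_in_carrier K assms by blast+
    ultimately have "w = x \<otimes> (u \<otimes> k)" using wc kS by (simp add: m_assoc)
    moreover have "u \<otimes> k \<in> gen K" using * kS gen_closed K by blast
    ultimately show ?thesis using * by blast
  qed
qed

text \<open>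
  Deodhar's lemma. If \<open>j x q\<close> is shorter than \<open>j x\<close> for some \<open>q \<in> K\<close>, the exchange condition deletes a
  letter from \<open>j x\<close>. It cannot be a letter of \<open>x\<close>, as \<open>x\<close> is minimal, so it is \<open>j\<close> itself.
\<close>

lemma left_ascent_cases:
  assumes K: "K \<subseteq> S" and x: "x \<in> min_right K" and j: "j \<in> S" "ell x < ell (j \<otimes> x)"
  shows "j \<otimes> x \<in> min_right K \<or> (\<exists>q\<in>K. j \<otimes> x = x \<otimes> q)"
proof (rule ccontr)
  assume neg: "\<not> ?thesis"
  have xc: "x \<in> carrier W" using x by (simp add: min_right_def)
  obtain q where q: "q \<in> K" "\<not> ell (j \<otimes> x) < ell (j \<otimes> x \<otimes> q)"
    using neg xc j by (auto simp: min_right_def)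
  have qS: "q \<in> S" using q K by auto
  have less: "ell (j \<otimes> x \<otimes> q) < ell (j \<otimes> x)"
    using len_mult_gen[of "j \<otimes> x" q] q qS xc j by auto
  obtain xs where xs: "xs \<in> lists S" "ev xs = x" "length xs = ell x" using ex_reduced_word xc by blast
  obtain us s vs where d: "j # xs = us @ s # vs" "ev (j # xs) \<otimes> q = ev (us @ vs)"
    using strong_exchange[of "j # xs" q] reflection_gen qS xs less j by auto
  show False
  proof (cases us)
    case Nil
    hence "j \<otimes> x \<otimes> q = x" using d xs by simp
    hence "j \<otimes> (j \<otimes> x \<otimes> q) = j \<otimes> x" by simp
    hence "x \<otimes> q = j \<otimes> x" using xc j qS by (simp add: m_assoc)
    thus False using neg q by auto
  next
    case (Cons j' us')
    hence xs': "xs = us' @ s # vs" "j' = j" using d by auto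
    have in': "us' \<in> lists S" "vs \<in> lists S" using xs' xs by auto
    have "j \<otimes> (x \<otimes> q) = j \<otimes> ev (us' @ vs)" using d Cons xs xs' in' xc j qS by (simp add: m_assoc)
    hence "x \<otimes> q = ev (us' @ vs)" using xc j qS in' by (simp del: ev_append)
    hence "ell (x \<otimes> q) < ell x" using len_word_le[of "us' @ vs"] in' xs xs' by auto
    thus False using x q by (auto simp: min_right_def)
  qed
qed

section \<open>Poincare series of unique factorisations\<close>

lemma finite_len_eq:
  assumes "finite S" "X \<subseteq> carrier W"
  shows "finite {x \<in> X. ell x = n}"
proof (rule finite_subset)
  show "{x \<in> X. ell x = n} \<subseteq> ev ` {ws. set ws \<subseteq> S \<and> length ws = n}"
  proof
    fix x assume "x \<in> {x \<in> X. ell x = n}"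
    then obtain ws where "ws \<in> lists S" "ev ws = x" "length ws = n"
      using ex_reduced_word assms by blast
    thus "x \<in> ev ` {ws. set ws \<subseteq> S \<and> length ws = n}" by (auto simp: in_lists_conv_set)
  qed
  show "finite (ev ` {ws. set ws \<subseteq> S \<and> length ws = n})"
    using finite_lists_length_eq[OF assms(1)] by simp
qed

text \<open>
  All identities between Poincare series below are instances of this: \<open>X\<close> is in bijection, with
  lengths adding, with a finite disjoint union of products of sets.
\<close>

lemma poincare_sum_products:
  assumes S: "finite S" and A: "finite A"
    and bij: "bij_betw (\<lambda>(i, y, z). f y z) (SIGMA i:A. Y i \<times> Z i) X"
    and len: "\<And>i y z. \<lbrakk>i \<in> A; y \<in> Y i; z \<in> Z i\<rbrakk> \<Longrightarrow> ell (f y z) = ell y + ell z"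
    and Y: "\<And>i. i \<in> A \<Longrightarrow> Y i \<subseteq> carrier W" and Z: "\<And>i. i \<in> A \<Longrightarrow> Z i \<subseteq> carrier W"
  shows "poincare W S X = (\<Sum>i\<in>A. poincare W S (Y i) * poincare W S (Z i))"
proof (rule fps_ext)
  fix n
  define D where "D = (SIGMA i:A. SIGMA k:{0..n}. {y \<in> Y i. ell y = k} \<times> {z \<in> Z i. ell z = n - k})"
  have "bij_betw (\<lambda>(i, k, y, z). f y z) D {x \<in> X. ell x = n}"
    unfolding bij_betw_def
  proof
    show "inj_on (\<lambda>(i, k, y, z). f y z) D"
    proof (rule inj_onI, clarsimp)
      fix i k y z i' k' y' z'
      assume D: "(i, k, y, z) \<in> D" "(i', k', y', z') \<in> D" and eq: "f y z = f y' z'"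
      have "(i, y, z) = (i', y', z')"
        using bij_betw_imp_inj_on[OF bij] by (rule inj_onD) (use D eq in \<open>auto simp: D_def\<close>)
      thus "i = i' \<and> k = k' \<and> y = y' \<and> z = z'" using D by (auto simp: D_def)
    qed
    show "(\<lambda>(i, k, y, z). f y z) ` D = {x \<in> X. ell x = n}" (is "?L = ?R")
    proof
      show "?L \<subseteq> ?R"
      proof (rule image_subsetI, clarsimp)
        fix i k y z assume "(i, k, y, z) \<in> D"
        hence *: "i \<in> A" "y \<in> Y i" "z \<in> Z i" "ell y + ell z = n" by (auto simp: D_def)
        have "(\<lambda>(i, y, z). f y z) (i, y, z) \<in> X"
          using bij_betw_apply[OF bij, of "(i, y, z)"] * by blast
        thus "f y z \<in> X \<and> ell (f y z) = n" using len * by simp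
      qed
      show "?R \<subseteq> ?L"
      proof
        fix x assume x: "x \<in> ?R"
        then obtain i y z where "i \<in> A" "y \<in> Y i" "z \<in> Z i" "x = f y z"
          using bij_betw_imp_surj_on[OF bij] by force
        moreover from this have "ell y + ell z = n" using len x by auto
        ultimately show "x \<in> ?L" by (intro image_eqI[of _ _ "(i, ell y, y, z)"]) (auto simp: D_def)
      qed
    qed
  qed
  hence "card {x \<in> X. ell x = n} = card D" by (simp add: bij_betw_same_card)
  also have "\<dots> = (\<Sum>i\<in>A. \<Sum>k=0..n. card {y \<in> Y i. ell y = k} * card {z \<in> Z i. ell z = n - k})"
    unfolding D_def using A Y Z finite_len_eq[OF S]
    by (subst card_SigmaI) (auto intro!: sum.cong simp: card_SigmaI card_cartesian_product)
  finally show "poincare W S X $ n = (\<Sum>i\<in>A. poincare W S (Y i) * poincare W S (Z i)) $ n"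
    by (simp add: poincare_def fps_sum_nth fps_mult_nth)
qed

lemma poincare_empty [simp]: "poincare W S {} = 0"
  by (rule fps_ext) (simp add: poincare_def)

lemma poincare_one [simp]: "poincare W S {\<one>} = 1"
proof (rule fps_ext)
  fix n
  have "{x \<in> {\<one>}. ell x = n} = (if n = 0 then {\<one>} else {})" by auto
  thus "poincare W S {\<one>} $ n = 1 $ n" by (simp add: poincare_def)
qed

lemma poincare_nth_0: "X \<subseteq> carrier W \<Longrightarrow> poincare W S X $ 0 = (if \<one> \<in> X then 1 else 0)"
proof -
  assume X: "X \<subseteq> carrier W"
  have "{x \<in> X. ell x = 0} = (if \<one> \<in> X then {\<one>} else {})" using X len_eq_0 by auto
  thus ?thesis by (simp add: poincare_def)
qed

section \<open>Double coset representatives in a chain of parabolic subgroups\<close>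

lemma mem_conj_set:
  assumes "y \<in> carrier W" "A \<subseteq> S" "r \<in> carrier W"
  shows "r \<in> conj_set W y A \<longleftrightarrow> (\<exists>a\<in>A. r \<otimes> y = y \<otimes> a)"
proof -
  have "r = y \<otimes> a \<otimes> inv y \<longleftrightarrow> r \<otimes> y = y \<otimes> a" if "a \<in> A" for a
  proof
    have a: "a \<in> carrier W" using that assms by auto
    show "r = y \<otimes> a \<otimes> inv y \<Longrightarrow> r \<otimes> y = y \<otimes> a" using a assms by (simp add: m_assoc)
    assume "r \<otimes> y = y \<otimes> a"
    hence "r \<otimes> y \<otimes> inv y = y \<otimes> a \<otimes> inv y" by simp
    thus "r = y \<otimes> a \<otimes> inv y" using a assms by (simp add: m_assoc)
  qed
  thus ?thesis unfolding conj_set_def by auto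
qed

lemma mem_conj_set_inv:
  assumes "x \<in> carrier W" "A \<subseteq> S" "r \<in> carrier W"
  shows "r \<in> conj_set W (inv x) A \<longleftrightarrow> (\<exists>a\<in>A. a \<otimes> x = x \<otimes> r)"
proof -
  have "r \<otimes> inv x = inv x \<otimes> a \<longleftrightarrow> a \<otimes> x = x \<otimes> r" if "a \<in> A" for a
  proof
    have a: "a \<in> carrier W" using that assms by auto
    assume "r \<otimes> inv x = inv x \<otimes> a"
    hence "x \<otimes> (r \<otimes> inv x) \<otimes> x = x \<otimes> (inv x \<otimes> a) \<otimes> x" by simp
    thus "a \<otimes> x = x \<otimes> r" using a assms by (simp add: m_assoc)
  next
    have a: "a \<in> carrier W" using that assms by auto
    assume "a \<otimes> x = x \<otimes> r"
    hence "inv x \<otimes> (a \<otimes> x) \<otimes> inv x = inv x \<otimes> (x \<otimes> r) \<otimes> inv x" by simp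
    thus "r \<otimes> inv x = inv x \<otimes> a" using a assms by (simp add: m_assoc)
  qed
  thus ?thesis using mem_conj_set[of "inv x" A r] assms by auto
qed

lemma card_conj_set:
  assumes "y \<in> carrier W" "A \<subseteq> S"
  shows "card (conj_set W y A) = card A"
  unfolding conj_set_def using assms
  by (intro card_image inj_onI) (auto simp: subset_iff)

lemma conj_set_one: "A \<subseteq> S \<Longrightarrow> conj_set W \<one> A = A"
  unfolding conj_set_def by (force simp: subset_iff)

lemma double_reps_iff:
  assumes "J \<subseteq> S" "K \<subseteq> S" "L \<subseteq> S"
  shows "x \<in> double_reps W S L J K \<longleftrightarrow> x \<in> gen L \<and> x \<in> min_right K \<and> inv x \<in> min_right J"
proof (cases "x \<in> gen L")
  case True
  hence x: "x \<in> carrier W" using assms gen_in_carrier by blast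
  have "ell (inv x \<otimes> j) = ell (j \<otimes> x)" if "j \<in> J" for j
  proof -
    have "j \<in> S" using that assms by auto
    thus ?thesis using len_inv[of "j \<otimes> x"] x by (simp add: inv_mult_group)
  qed
  thus ?thesis using True x by (auto simp: double_reps_def min_right_def)
qed (simp add: double_reps_def)

lemma double_reps_carrier: "L \<subseteq> S \<Longrightarrow> double_reps W S L J K \<subseteq> carrier W"
  using gen_in_carrier by (auto simp: double_reps_def)

lemma double_reps_inv:
  assumes "J \<subseteq> S" "K \<subseteq> S" "L \<subseteq> S" "x \<in> carrier W"
  shows "inv x \<in> double_reps W S L K J \<longleftrightarrow> x \<in> double_reps W S L J K"
proof -
  have "inv x \<in> gen L \<longleftrightarrow> x \<in> gen L" using gen_closed(3)[OF assms(3)] assms(4) by (metis inv_inv)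
  thus ?thesis using assms by (auto simp: double_reps_iff)
qed

lemma one_in_double_reps: "\<lbrakk>J \<subseteq> S; K \<subseteq> S\<rbrakk> \<Longrightarrow> \<one> \<in> double_reps W S L J K"
  using len_gen by (auto simp: double_reps_def subset_iff generate.one)

lemma double_reps_full:
  assumes "L \<subseteq> S" "x \<in> double_reps W S L J K" "J = L \<or> K = L"
  shows "x = \<one>"
  using ex_right_descent[OF assms(1), of x] ex_left_descent[OF assms(1), of x] assms(2,3)
  by (fastforce simp: double_reps_def)

text \<open>
  Comparing lengths in \<open>j x = x g\<close> shows that \<open>g\<close> has length one.
\<close>

lemma conj_gen_in_parabolic:
  assumes "K \<subseteq> S" "x \<in> min_right K" "j \<in> S" "ell x < ell (j \<otimes> x)" "g \<in> gen K" "j \<otimes> x = x \<otimes> g"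
  shows "g \<in> K"
proof -
  have "ell (j \<otimes> x) = ell x + 1" using len_gen_mult[of x j] assms by (auto simp: min_right_def)
  hence "ell g = 1" using min_right_len_add[OF assms(1,2,5)] assms(6) by simp
  thus ?thesis using gen_len_one assms by blast
qed

text \<open>
  Right descents of \<open>x u\<close> in \<open>K'\<close> are those of \<open>u\<close>. For a left ascent \<open>j\<close> of \<open>x\<close>, Deodhar's lemma leaves two
  cases: either \<open>j x\<close> is again minimal and the length of \<open>j x u\<close> grows automatically, or \<open>j x = x q\<close> and
  the question becomes whether \<open>q\<close> is a left descent of \<open>u\<close>. The elements \<open>q\<close> that occur form
  \<open>K \<inter> x\<^sup>-\<^sup>1 J x\<close>.
\<close>

lemma double_reps_mult_iff:
  assumes sub: "J \<subseteq> S" "K \<subseteq> L" "L \<subseteq> S" "K' \<subseteq> K"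
    and x: "x \<in> gen L" "x \<in> min_right K" and u: "u \<in> gen K"
  shows "x \<otimes> u \<in> double_reps W S L J K' \<longleftrightarrow>
     x \<in> double_reps W S L J K \<and> u \<in> double_reps W S K (K \<inter> conj_set W (inv x) J) K'"
proof -
  have K: "K \<subseteq> S" "K' \<subseteq> S" using sub by auto
  have c [simp]: "x \<in> carrier W" "u \<in> carrier W" using x u gen_in_carrier K sub by auto
  have xu: "x \<otimes> u \<in> gen L" using x u gen_closed[OF sub(3)] gen_mono[OF sub(2)] by auto
  have add: "ell (x \<otimes> g) = ell x + ell g" if "g \<in> gen K" for g
    using min_right_len_add[OF K(1) x(2) that] .
  have right: "ell (x \<otimes> u) < ell (x \<otimes> u \<otimes> k) \<longleftrightarrow> ell u < ell (u \<otimes> k)" if "k \<in> K'" for k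
  proof -
    have "k \<in> S" "k \<in> gen K" using that sub by (auto intro: generate.incl)
    hence "u \<otimes> k \<in> gen K" "x \<otimes> u \<otimes> k = x \<otimes> (u \<otimes> k)" using u gen_closed[OF K(1)] by (auto simp: m_assoc)
    thus ?thesis using add u by simp
  qed
  have left: "(\<forall>j\<in>J. ell (x \<otimes> u) < ell (j \<otimes> (x \<otimes> u))) \<longleftrightarrow>
    (\<forall>j\<in>J. ell x < ell (j \<otimes> x)) \<and> (\<forall>q\<in>K \<inter> conj_set W (inv x) J. ell u < ell (q \<otimes> u))"
    (is "?l \<longleftrightarrow> ?r1 \<and> ?r2")
  proof
    assume l: ?l
    have ?r1
    proof
      fix j assume j: "j \<in> J"
      hence jS: "j \<in> S" using sub by auto
      have "j \<otimes> (x \<otimes> u) = j \<otimes> x \<otimes> u" using jS by (simp add: m_assoc)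
      hence "ell x + ell u < ell (j \<otimes> x) + ell u"
        using l j add[OF u] len_mult_le[of "j \<otimes> x" u] jS by fastforce
      thus "ell x < ell (j \<otimes> x)" by simp
    qed
    moreover have ?r2
    proof
      fix q assume q: "q \<in> K \<inter> conj_set W (inv x) J"
      hence "q \<in> S" using K by auto
      then obtain j where j: "j \<in> J" "j \<otimes> x = x \<otimes> q" using mem_conj_set_inv[of x J q] sub q by auto
      have qS: "q \<in> S" "q \<in> gen K" "j \<in> S" using q j K sub by (auto intro: generate.incl)
      have "j \<otimes> (x \<otimes> u) = j \<otimes> x \<otimes> u" using qS by (simp add: m_assoc)
      also have "\<dots> = x \<otimes> (q \<otimes> u)" using qS j by (simp add: m_assoc)
      finally show "ell u < ell (q \<otimes> u)"
        using l j add[OF u] add[OF gen_closed(2)[OF K(1) qS(2) u]] by fastforce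
    qed
    ultimately show "?r1 \<and> ?r2" ..
  next
    assume r: "?r1 \<and> ?r2"
    show ?l
    proof
      fix j assume j: "j \<in> J"
      hence jS: "j \<in> S" using sub by auto
      have jl: "ell x < ell (j \<otimes> x)" using r j by auto
      have ass: "j \<otimes> (x \<otimes> u) = j \<otimes> x \<otimes> u" using jS by (simp add: m_assoc)
      from left_ascent_cases[OF K(1) x(2) jS jl]
      show "ell (x \<otimes> u) < ell (j \<otimes> (x \<otimes> u))"
      proof
        assume "j \<otimes> x \<in> min_right K"
        thus ?thesis using min_right_len_add[OF K(1) _ u] jl add[OF u] ass by simp
      next
        assume "\<exists>q\<in>K. j \<otimes> x = x \<otimes> q"
        then obtain q where q: "q \<in> K" "j \<otimes> x = x \<otimes> q" by blast
        have qS: "q \<in> S" "q \<in> gen K" using q K by (auto intro: generate.incl)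
        have "q \<in> conj_set W (inv x) J" using mem_conj_set_inv[of x J q] qS q j sub by auto
        hence "ell u < ell (q \<otimes> u)" using r q by auto
        moreover have "j \<otimes> (x \<otimes> u) = x \<otimes> (q \<otimes> u)" using ass q qS by (simp add: m_assoc)
        ultimately show ?thesis using add[OF u] add[OF gen_closed(2)[OF K(1) qS(2) u]] by simp
      qed
    qed
  qed
  show ?thesis using xu x u left right by (auto simp: double_reps_def min_right_def)
qed

text \<open>
  If \<open>j \<in> J\<close> is conjugated into \<open>K'\<close> by \<open>x u\<close>, then \<open>x\<close> already conjugates it into \<open>W\<^sub>K\<close> and therefore,
  by comparison of lengths, into \<open>K\<close>.
\<close>

lemma inter_conj_set_mult:
  assumes sub: "J \<subseteq> S" "K \<subseteq> L" "L \<subseteq> S" "K' \<subseteq> K"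
    and x: "x \<in> double_reps W S L J K" and u: "u \<in> gen K"
  shows "K' \<inter> conj_set W (inv (x \<otimes> u)) J = K' \<inter> conj_set W (inv u) (K \<inter> conj_set W (inv x) J)"
proof -
  have K: "K \<subseteq> S" using sub by auto
  have xm: "x \<in> min_right K" "x \<in> carrier W" using x sub K by (auto simp: double_reps_iff min_right_def)
  have uc: "u \<in> carrier W" using u gen_in_carrier K by blast
  have "(\<exists>j\<in>J. j \<otimes> (x \<otimes> u) = x \<otimes> u \<otimes> k) \<longleftrightarrow>
        (\<exists>q\<in>K \<inter> conj_set W (inv x) J. q \<otimes> u = u \<otimes> k)" if "k \<in> K'" for k
  proof -
    have k: "k \<in> S" "k \<in> gen K" using that sub by (auto intro: generate.incl)
    show ?thesis
    proof
      assume "\<exists>j\<in>J. j \<otimes> (x \<otimes> u) = x \<otimes> u \<otimes> k"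
      then obtain j where j: "j \<in> J" "j \<otimes> (x \<otimes> u) = x \<otimes> u \<otimes> k" by blast
      have jS: "j \<in> S" using j sub by auto
      define q where "q = u \<otimes> k \<otimes> inv u"
      have q: "q \<in> gen K" unfolding q_def using u k gen_closed[OF K] by blast
      have "j \<otimes> (x \<otimes> u) \<otimes> inv u = x \<otimes> u \<otimes> k \<otimes> inv u" using j by simp
      hence jx: "j \<otimes> x = x \<otimes> q" unfolding q_def using jS k xm uc by (simp add: m_assoc)
      have "q \<in> K" using conj_gen_in_parabolic[OF K xm(1) jS _ q jx] x j by (auto simp: double_reps_def)
      moreover from this have "q \<in> conj_set W (inv x) J"
        using mem_conj_set_inv[of x J q] xm sub j jx K by auto
      moreover have "q \<otimes> u = u \<otimes> k" unfolding q_def using uc k by (simp add: m_assoc)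
      ultimately show "\<exists>q\<in>K \<inter> conj_set W (inv x) J. q \<otimes> u = u \<otimes> k" by blast
    next
      assume "\<exists>q\<in>K \<inter> conj_set W (inv x) J. q \<otimes> u = u \<otimes> k"
      then obtain q where q: "q \<in> K" "q \<in> conj_set W (inv x) J" "q \<otimes> u = u \<otimes> k" by blast
      have qS: "q \<in> S" using q K by auto
      obtain j where j: "j \<in> J" "j \<otimes> x = x \<otimes> q"
        using mem_conj_set_inv[of x J q] xm sub qS q by auto
      have jS: "j \<in> S" using j sub by auto
      have "j \<otimes> (x \<otimes> u) = j \<otimes> x \<otimes> u" using jS xm uc by (simp add: m_assoc)
      also have "\<dots> = x \<otimes> (q \<otimes> u)" using j qS xm uc by (simp add: m_assoc)
      also have "\<dots> = x \<otimes> u \<otimes> k" using q xm uc k by (simp add: m_assoc)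
      finally show "\<exists>j\<in>J. j \<otimes> (x \<otimes> u) = x \<otimes> u \<otimes> k" using j by blast
    qed
  qed
  moreover have "k \<in> carrier W" if "k \<in> K'" for k using that sub K by auto
  moreover have "K \<inter> conj_set W (inv x) J \<subseteq> S" "x \<otimes> u \<in> carrier W" using K xm uc by auto
  ultimately show ?thesis using sub(1) uc by (auto simp: mem_conj_set_inv)
qed

lemma poincare_p_set_refine:
  assumes S: "finite S" and sub: "J \<subseteq> S" "K \<subseteq> L" "L \<subseteq> S" "K' \<subseteq> K"
  shows "poincare W S (p_set W S L Q' J K') =
    (\<Sum>Q\<in>Pow K. poincare W S (p_set W S L Q J K) * poincare W S (p_set W S K Q' Q K'))"
proof (rule poincare_sum_products[where f = "(\<otimes>)"])
  have K: "K \<subseteq> S" using sub by auto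
  have mem: "x \<in> gen L" "x \<in> min_right K" "x \<in> carrier W" if "x \<in> p_set W S L Q J K" for x Q
    using that sub K by (auto simp: p_set_def double_reps_iff min_right_def)
  have memu: "u \<in> gen K" "u \<in> carrier W" if "u \<in> p_set W S K Q' Q K'" for u Q
    using that K gen_in_carrier by (auto simp: p_set_def double_reps_def)
  show "finite (Pow K)" using S K by (simp add: finite_subset)
  show "p_set W S L Q J K \<subseteq> carrier W" for Q using mem by blast
  show "p_set W S K Q' Q K' \<subseteq> carrier W" for Q using memu by blast
  show "ell (x \<otimes> u) = ell x + ell u"
    if "x \<in> p_set W S L Q J K" "u \<in> p_set W S K Q' Q K'" for x u Q
    using min_right_len_add[OF K mem(2)[OF that(1)] memu(1)[OF that(2)]] .
  have prod: "x \<otimes> u \<in> p_set W S L Q' J K' \<longleftrightarrow>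
      x \<in> p_set W S L Q J K \<and> u \<in> p_set W S K Q' Q K'"
    if "x \<in> gen L" "x \<in> min_right K" "u \<in> gen K" "Q = K \<inter> conj_set W (inv x) J" for x u Q
    using double_reps_mult_iff[OF sub that(1-3)] inter_conj_set_mult[OF sub _ that(3), of x] that(4)
    by (auto simp: p_set_def)
  show "bij_betw (\<lambda>(Q, x, u). x \<otimes> u)
    (SIGMA Q:Pow K. p_set W S L Q J K \<times> p_set W S K Q' Q K') (p_set W S L Q' J K')"
    (is "bij_betw ?f ?D ?X")
    unfolding bij_betw_def
  proof
    show "inj_on ?f ?D"
    proof (rule inj_onI, clarsimp)
      fix Q x u R y v
      assume *: "x \<in> p_set W S L Q J K" "u \<in> p_set W S K Q' Q K'"
        "y \<in> p_set W S L R J K" "v \<in> p_set W S K Q' R K'" "x \<otimes> u = y \<otimes> v"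
      have "x = y \<and> u = v"
        using min_right_unique[OF K mem(2)[OF *(1)] mem(2)[OF *(3)] memu(1)[OF *(2)] memu(1)[OF *(4)] *(5)] .
      thus "Q = R \<and> x = y \<and> u = v" using * by (auto simp: p_set_def)
    qed
    show "?f ` ?D = ?X"
    proof
      show "?f ` ?D \<subseteq> ?X"
      proof clarify
        fix Q x u assume *: "x \<in> p_set W S L Q J K" "u \<in> p_set W S K Q' Q K'"
        have "Q = K \<inter> conj_set W (inv x) J" using * by (simp add: p_set_def)
        thus "x \<otimes> u \<in> ?X" using prod[OF mem(1,2)[OF *(1)] memu(1)[OF *(2)]] * by blast
      qed
      show "?X \<subseteq> ?f ` ?D"
      proof
        fix w assume w: "w \<in> ?X"
        hence "w \<in> gen L" by (simp add: p_set_def double_reps_def)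
        then obtain x u where xu: "x \<in> gen L" "x \<in> min_right K" "u \<in> gen K" "w = x \<otimes> u"
          using min_right_decomp[OF sub(2,3)] by blast
        define Q where "Q = K \<inter> conj_set W (inv x) J"
        have "x \<in> p_set W S L Q J K \<and> u \<in> p_set W S K Q' Q K'"
          using prod[OF xu(1-3) Q_def] w xu(4) by blast
        thus "w \<in> ?f ` ?D" using xu(4) by (intro image_eqI[of _ _ "(Q, x, u)"]) (auto simp: Q_def)
      qed
    qed
  qed
qed (rule S)

lemma conj_set_mult:
  assumes "u \<in> carrier W" "y \<in> carrier W" "A \<subseteq> S"
  shows "conj_set W (u \<otimes> y) A = conj_set W u (conj_set W y A)"
  unfolding conj_set_def image_image
proof (rule image_cong)
  fix a assume "a \<in> A"
  hence "a \<in> S" using assms by auto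
  thus "u \<otimes> y \<otimes> a \<otimes> inv (u \<otimes> y) = u \<otimes> (y \<otimes> a \<otimes> inv y) \<otimes> inv u"
    using assms by (simp add: m_assoc inv_mult_group)
qed simp

text \<open>
  The factorisation is now taken on the left, so \<open>double_reps_mult_iff\<close> is applied to the inverses. The
  additional point is that \<open>y K y\<^sup>-\<^sup>1\<close> consists of generators: \<open>u\<close> conjugates it into \<open>J \<subseteq> W\<^bsub>J1\<^esub>\<close>, so it lies
  in \<open>W\<^bsub>J1\<^esub>\<close>, and its elements have length one by \<open>conj_gen_in_parabolic\<close>.
\<close>

lemma h_set_mult_iff:
  assumes sub: "R \<subseteq> J" "J \<subseteq> J1" "J1 \<subseteq> L" "L \<subseteq> S" "K \<subseteq> S"
    and y: "y \<in> gen L" "inv y \<in> min_right J1" and u: "u \<in> gen J1"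
    and R1: "R1 = conj_set W y K"
  shows "u \<otimes> y \<in> h_set W S L R J K \<longleftrightarrow>
    R1 \<subseteq> J1 \<and> y \<in> h_set W S L R1 J1 K \<and> u \<in> h_set W S J1 R J R1"
proof -
  have J: "J \<subseteq> S" "J1 \<subseteq> S" using sub by auto
  have c [simp]: "u \<in> carrier W" "y \<in> carrier W" using y u gen_in_carrier J sub by auto
  have iff: "u \<otimes> y \<in> double_reps W S L J K \<longleftrightarrow>
      y \<in> double_reps W S L J1 K \<and> u \<in> double_reps W S J1 J (J1 \<inter> R1)"
  proof -
    have "u \<otimes> y \<in> double_reps W S L J K \<longleftrightarrow> inv y \<otimes> inv u \<in> double_reps W S L K J"
      using double_reps_inv[of J K L "u \<otimes> y"] sub J by (simp add: inv_mult_group)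
    also have "\<dots> \<longleftrightarrow> inv y \<in> double_reps W S L K J1 \<and>
        inv u \<in> double_reps W S J1 (J1 \<inter> conj_set W (inv (inv y)) K) J"
      using sub y u gen_closed(3) J by (intro double_reps_mult_iff) auto
    also have "conj_set W (inv (inv y)) K = R1" by (simp add: R1)
    also have "inv y \<in> double_reps W S L K J1 \<longleftrightarrow> y \<in> double_reps W S L J1 K"
      using sub J by (intro double_reps_inv) auto
    also have "inv u \<in> double_reps W S J1 (J1 \<inter> R1) J \<longleftrightarrow> u \<in> double_reps W S J1 J (J1 \<inter> R1)"
      using J by (intro double_reps_inv) auto
    finally show ?thesis .
  qed
  have conj: "conj_set W (u \<otimes> y) K = conj_set W u R1" using sub by (simp add: R1 conj_set_mult)
  have R1J: "R1 \<subseteq> J1" if uy: "u \<otimes> y \<in> h_set W S L R J K"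
  proof
    fix g assume "g \<in> R1"
    then obtain k where k: "k \<in> K" "g = y \<otimes> k \<otimes> inv y" by (auto simp: R1 conj_set_def)
    have kS: "k \<in> S" using k sub by auto
    have gc: "g \<in> carrier W" using k kS by simp
    have "u \<otimes> g \<otimes> inv u \<in> conj_set W u R1" using \<open>g \<in> R1\<close> by (simp add: conj_set_def)
    hence "u \<otimes> g \<otimes> inv u \<in> J1" using uy conj sub by (auto simp: h_set_def)
    hence "inv u \<otimes> (u \<otimes> g \<otimes> inv u) \<otimes> u \<in> gen J1"
      by (intro gen_closed(2)[OF J(2)] gen_closed(3)[OF J(2)] u gen_closed(4)[OF J(2)])
    hence g: "g \<in> gen J1" using gc by (simp add: m_assoc)
    have "inv y \<in> double_reps W S L K J1"
      using iff uy double_reps_inv[of J1 K L y] sub J by (auto simp: h_set_def)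
    hence "ell (inv y) < ell (k \<otimes> inv y)" using k by (auto simp: double_reps_def)
    moreover have "k \<otimes> inv y = inv y \<otimes> g" using k kS by (simp add: m_assoc)
    ultimately show "g \<in> J1" using conj_gen_in_parabolic[OF J(2) y(2) kS _ g] by blast
  qed
  show ?thesis using iff conj R1J by (auto simp: h_set_def R1 Int_absorb1)
qed

lemma poincare_h_set_refine:
  assumes S: "finite S" and sub: "R \<subseteq> J" "J \<subseteq> J1" "J1 \<subseteq> L" "L \<subseteq> S" "K \<subseteq> S"
  shows "poincare W S (h_set W S L R J K) =
    (\<Sum>R1\<in>Pow J1. poincare W S (h_set W S L R1 J1 K) * poincare W S (h_set W S J1 R J R1))"
proof (rule poincare_sum_products[where f = "\<lambda>y u. u \<otimes> y"])
  have J: "J \<subseteq> S" "J1 \<subseteq> S" using sub by auto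
  have mem: "y \<in> gen L" "inv y \<in> min_right J1" "y \<in> carrier W" if "y \<in> h_set W S L R1 J1 K" for y R1
    using that sub J gen_in_carrier by (auto simp: h_set_def double_reps_iff)
  have memu: "u \<in> gen J1" "u \<in> carrier W" if "u \<in> h_set W S J1 R J R1" for u R1
    using that J gen_in_carrier by (auto simp: h_set_def double_reps_def)
  show "finite (Pow J1)" using S J by (simp add: finite_subset)
  show "h_set W S L R1 J1 K \<subseteq> carrier W" for R1 using mem by blast
  show "h_set W S J1 R J R1 \<subseteq> carrier W" for R1 using memu by blast
  show "ell (u \<otimes> y) = ell y + ell u"
    if "y \<in> h_set W S L R1 J1 K" "u \<in> h_set W S J1 R J R1" for y u R1
  proof -
    have "ell (inv y \<otimes> inv u) = ell (inv y) + ell (inv u)"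
      using min_right_len_add[OF J(2) mem(2)[OF that(1)] gen_closed(3)[OF J(2) memu(1)[OF that(2)]]] .
    thus ?thesis using len_inv[of "u \<otimes> y"] mem(3)[OF that(1)] memu(2)[OF that(2)]
      by (simp add: inv_mult_group)
  qed
  show "bij_betw (\<lambda>(R1, y, u). u \<otimes> y)
    (SIGMA R1:Pow J1. h_set W S L R1 J1 K \<times> h_set W S J1 R J R1) (h_set W S L R J K)"
    (is "bij_betw ?f ?D ?X")
    unfolding bij_betw_def
  proof
    show "inj_on ?f ?D"
    proof (rule inj_onI, clarsimp)
      fix R1 y u R2 z v
      assume *: "y \<in> h_set W S L R1 J1 K" "u \<in> h_set W S J1 R J R1"
        "z \<in> h_set W S L R2 J1 K" "v \<in> h_set W S J1 R J R2" "u \<otimes> y = v \<otimes> z"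
      have c: "y \<in> carrier W" "z \<in> carrier W" "u \<in> carrier W" "v \<in> carrier W"
        using mem(3)[OF *(1)] mem(3)[OF *(3)] memu(2)[OF *(2)] memu(2)[OF *(4)] by auto
      have "inv (u \<otimes> y) = inv (v \<otimes> z)" using * by simp
      hence "inv y \<otimes> inv u = inv z \<otimes> inv v" using c by (simp add: inv_mult_group)
      hence "inv y = inv z \<and> inv u = inv v"
        using min_right_unique[OF J(2) mem(2)[OF *(1)] mem(2)[OF *(3)]
          gen_closed(3)[OF J(2) memu(1)[OF *(2)]] gen_closed(3)[OF J(2) memu(1)[OF *(4)]]] by blast
      hence "y = z \<and> u = v" using c by (metis inv_inv)
      thus "R1 = R2 \<and> y = z \<and> u = v" using * by (auto simp: h_set_def)
    qed
    show "?f ` ?D = ?X"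
    proof
      show "?f ` ?D \<subseteq> ?X"
      proof clarify
        fix R1 y u assume *: "R1 \<subseteq> J1" "y \<in> h_set W S L R1 J1 K" "u \<in> h_set W S J1 R J R1"
        have "R1 = conj_set W y K" using * by (simp add: h_set_def)
        thus "u \<otimes> y \<in> ?X" using h_set_mult_iff[OF sub mem(1,2)[OF *(2)] memu(1)[OF *(3)]] * by blast
      qed
      show "?X \<subseteq> ?f ` ?D"
      proof
        fix w assume w: "w \<in> ?X"
        hence "w \<in> gen L" by (simp add: h_set_def double_reps_def)
        hence wc: "w \<in> carrier W" and "inv w \<in> gen L" using gen_closed(3) gen_in_carrier sub by auto
        then obtain x v where xv: "x \<in> gen L" "x \<in> min_right J1" "v \<in> gen J1" "inv w = x \<otimes> v"
          using min_right_decomp[OF sub(3,4)] by blast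
        have c: "x \<in> carrier W" "v \<in> carrier W" using xv gen_in_carrier J sub by auto
        define y u where "y = inv x" and "u = inv v"
        have y: "y \<in> gen L" "inv y \<in> min_right J1" and u: "u \<in> gen J1"
          using xv c gen_closed(3) J sub by (auto simp: y_def u_def)
        have "w = inv (inv w)" using wc by simp
        hence wuy: "w = u \<otimes> y" using xv c by (simp add: y_def u_def inv_mult_group)
        define R1 where "R1 = conj_set W y K"
        have "R1 \<subseteq> J1 \<and> y \<in> h_set W S L R1 J1 K \<and> u \<in> h_set W S J1 R J R1"
          using h_set_mult_iff[OF sub y u R1_def] w wuy by blast
        thus "w \<in> ?f ` ?D" using wuy by (intro image_eqI[of _ _ "(R1, y, u)"]) auto
      qed
    qed
  qed
qed (rule S)

lemma poincare_disjoint_UN: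
  assumes "finite S" "finite A" "\<And>i. i \<in> A \<Longrightarrow> Y i \<subseteq> carrier W"
    and "\<And>i j. \<lbrakk>i \<in> A; j \<in> A; i \<noteq> j\<rbrakk> \<Longrightarrow> Y i \<inter> Y j = {}"
  shows "poincare W S (\<Union>i\<in>A. Y i) = (\<Sum>i\<in>A. poincare W S (Y i))"
proof -
  have "poincare W S (\<Union>i\<in>A. Y i) = (\<Sum>i\<in>A. poincare W S (Y i) * poincare W S {\<one>})"
  proof (rule poincare_sum_products[where f = "\<lambda>y z. y"])
    show "bij_betw (\<lambda>(i, y, z). y) (SIGMA i:A. Y i \<times> {\<one>}) (\<Union>i\<in>A. Y i)"
      using assms(4) by (force simp: bij_betw_def inj_on_def image_def)
  qed (use assms in auto)
  thus ?thesis by simp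
qed

section \<open>Consequences of the linear relations\<close>

lemma p_set_empty: "\<not> Q \<subseteq> K \<Longrightarrow> p_set W S L Q J K = {}"
  by (auto simp: p_set_def)

lemma one_in_p_set:
  "\<lbrakk>J \<subseteq> S; K \<subseteq> S\<rbrakk> \<Longrightarrow> \<one> \<in> p_set W S L Q J K \<longleftrightarrow> K \<inter> J = Q"
  by (simp add: p_set_def one_in_double_reps conj_set_one)

lemma one_in_h_set:
  "\<lbrakk>J \<subseteq> S; K \<subseteq> S\<rbrakk> \<Longrightarrow> \<one> \<in> h_set W S L R J K \<longleftrightarrow> K = R"
  by (simp add: h_set_def one_in_double_reps conj_set_one)

lemma p_set_carrier: "L \<subseteq> S \<Longrightarrow> p_set W S L Q J K \<subseteq> carrier W"
  and h_set_carrier: "L \<subseteq> S \<Longrightarrow> h_set W S L R J K \<subseteq> carrier W"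
  unfolding p_set_def h_set_def using double_reps_carrier by blast+

lemma h_set_empty:
  assumes "L \<subseteq> S" "K \<subseteq> S" "card R \<noteq> card K"
  shows "h_set W S L R J K = {}"
  using assms(3) card_conj_set[OF _ assms(2)] subsetD[OF double_reps_carrier[OF assms(1)]]
  by (auto simp: h_set_def)

lemma rational_subset_one: "X \<subseteq> {\<one>} \<Longrightarrow> rational_fps (poincare W S X)"
  by (cases "X = {}") (auto simp: subset_singleton_iff)

lemma p_set_diag_eq_h_set:
  assumes "finite S" "L \<subseteq> S" "J \<subseteq> S" "K \<subseteq> S" "card J = card K"
  shows "p_set W S L K J K = h_set W S L J J K"
proof -
  have "K \<inter> conj_set W (inv x) J = K \<longleftrightarrow> conj_set W x K = J" if x: "x \<in> carrier W" for x
  proof -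
    have "conj_set W x (conj_set W (inv x) J) = J"
      using conj_set_mult[of x "inv x" J] x assms by (simp add: conj_set_one)
    moreover have "conj_set W (inv x) (conj_set W x K) = K"
      using conj_set_mult[of "inv x" x K] x assms by (simp add: conj_set_one)
    moreover have "conj_set W (inv x) J = K" if "K \<subseteq> conj_set W (inv x) J"
    proof -
      have "finite (conj_set W (inv x) J)" using assms by (simp add: conj_set_def finite_subset)
      thus ?thesis using that card_conj_set[of "inv x" J] x assms by (metis card_subset_eq inv_closed)
    qed
    ultimately show ?thesis by (metis Int_absorb2 Int_lower2 order_refl)
  qed
  thus ?thesis using double_reps_carrier[OF assms(2)] by (auto simp: p_set_def h_set_def)
qed

text \<open>
  The refinement identity with \<open>Q' = K'\<close> ranging over the subsets of \<open>K\<close> is a linear system for the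
  series \<open>p(L;Q,J,K)\<close>. Its matrix entry at \<open>(K', Q)\<close> has constant term \<open>1\<close> if \<open>K' \<subseteq> Q\<close> and \<open>0\<close> otherwise.
\<close>

lemma rational_p_of_diag:
  assumes S: "finite S"
    and diag: "\<And>L J K. \<lbrakk>L \<subseteq> S; J \<subseteq> L; K \<subseteq> L\<rbrakk> \<Longrightarrow> rational_fps (poincare W S (p_set W S L K J K))"
    and sub: "L \<subseteq> S" "J \<subseteq> L" "K \<subseteq> L"
  shows "rational_fps (poincare W S (p_set W S L Q J K))"
proof (cases "Q \<subseteq> K")
  case True
  have K: "K \<subseteq> S" "J \<subseteq> S" using sub by auto
  have "\<forall>Q\<in>Pow K. rational_fps (poincare W S (p_set W S L Q J K))"
  proof (rule rational_fps_linear_system[where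
        M = "\<lambda>K' Q. poincare W S (p_set W S K K' Q K')" and y = "\<lambda>K'. poincare W S (p_set W S L K' J K')"])
    show "finite (Pow K)" using S K by (simp add: finite_subset)
    show "rational_fps (poincare W S (p_set W S K a b a))" if "a \<in> Pow K" "b \<in> Pow K" for a b
      using that K by (intro diag) auto
    show "rational_fps (poincare W S (p_set W S L a J a))" if "a \<in> Pow K" for a
      using that sub by (intro diag) auto
    have nth: "poincare W S (p_set W S K a b a) $ 0 = (if a \<inter> b = a then 1 else 0)"
      if "a \<in> Pow K" "b \<in> Pow K" for a b
      using that K by (subst poincare_nth_0) (auto simp: one_in_p_set p_set_carrier)
    show "poincare W S (p_set W S K a a a) $ 0 = 1" if "a \<in> Pow K" for a
      using nth that by simp
    show "a \<le> b" if "a \<in> Pow K" "b \<in> Pow K" "poincare W S (p_set W S K a b a) $ 0 \<noteq> 0" for a b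
      using nth[OF that(1,2)] that(3) by (auto split: if_splits)
    show "(\<Sum>b\<in>Pow K. poincare W S (p_set W S K a b a) * poincare W S (p_set W S L b J K)) =
        poincare W S (p_set W S L a J a)" if "a \<in> Pow K" for a
      using poincare_p_set_refine[OF S K(2) sub(3,1), of a] that by (simp add: mult.commute)
  qed
  thus ?thesis using True by blast
qed (simp add: p_set_empty)

text \<open>
  Refine from a maximal proper subset of \<open>L\<close> containing \<open>K\<close>; the second factors live over that
  smaller set. For \<open>K = L\<close> the only minimal representative is the identity.
\<close>

lemma rational_p_of_maximal:
  assumes S: "finite S"
    and max: "\<And>L Q J K. \<lbrakk>L \<subseteq> S; Q \<subseteq> L; J \<subseteq> L; K \<subseteq> L; card K + 1 = card L\<rbrakk> \<Longrightarrow>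
      rational_fps (poincare W S (p_set W S L Q J K))"
    and "L \<subseteq> S" "J \<subseteq> L" "K \<subseteq> L"
  shows "rational_fps (poincare W S (p_set W S L Q J K))"
  using assms(3-)
proof (induction "card L" arbitrary: L Q J K rule: less_induct)
  case less
  have fin: "finite L" using less.prems S finite_subset by blast
  show ?case
  proof (cases "K = L")
    case True
    thus ?thesis using less.prems double_reps_full[of L]
      by (intro rational_subset_one) (auto simp: p_set_def)
  next
    case False
    then obtain l where l: "l \<in> L" "l \<notin> K" using less.prems by blast
    define M where "M = L - {l}"
    have M: "M \<subseteq> L" "K \<subseteq> M" "card M + 1 = card L"
      using l less.prems card_Suc_Diff1[OF fin l(1)] by (auto simp: M_def)
    have "rational_fps (poincare W S (p_set W S L R J M) * poincare W S (p_set W S M Q R K))"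
      if "R \<in> Pow M" for R
    proof (rule rational_fps_mult)
      show "rational_fps (poincare W S (p_set W S L R J M))"
        using that M less.prems by (intro max) auto
      show "rational_fps (poincare W S (p_set W S M Q R K))"
        by (rule less.hyps) (use that M less.prems in auto)
    qed
    thus ?thesis using poincare_p_set_refine[OF S _ M(1) less.prems(1) M(2), of J Q] less.prems
      by (auto intro!: rational_fps_sum)
  qed
qed

lemma rational_h_of_maximal:
  assumes S: "finite S"
    and max: "\<And>L R J K. \<lbrakk>L \<subseteq> S; J \<subseteq> L; K \<subseteq> L; R \<subseteq> J; card J + 1 = card L\<rbrakk> \<Longrightarrow>
      rational_fps (poincare W S (h_set W S L R J K))"
    and "L \<subseteq> S" "J \<subseteq> L" "K \<subseteq> L" "R \<subseteq> J"
  shows "rational_fps (poincare W S (h_set W S L R J K))"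
  using assms(3-)
proof (induction "card L" arbitrary: L R J K rule: less_induct)
  case less
  have fin: "finite L" using less.prems S finite_subset by blast
  show ?case
  proof (cases "J = L")
    case True
    thus ?thesis using less.prems double_reps_full[of L]
      by (intro rational_subset_one) (auto simp: h_set_def)
  next
    case False
    then obtain l where l: "l \<in> L" "l \<notin> J" using less.prems by blast
    define M where "M = L - {l}"
    have M: "M \<subseteq> L" "J \<subseteq> M" "card M + 1 = card L"
      using l less.prems card_Suc_Diff1[OF fin l(1)] by (auto simp: M_def)
    have "rational_fps (poincare W S (h_set W S L T M K) * poincare W S (h_set W S M R J T))"
      if "T \<in> Pow M" for T
    proof (rule rational_fps_mult)
      have T: "T \<subseteq> M" "M \<subseteq> S" using that M less.prems by auto
      show "rational_fps (poincare W S (h_set W S L T M K))"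
        using T M less.prems by (intro max) auto
      show "rational_fps (poincare W S (h_set W S M R J T))"
        by (rule less.hyps) (use T M less.prems in auto)
    qed
    thus ?thesis using poincare_h_set_refine[OF S less.prems(4) M(2,1) less.prems(1), of K] less.prems
      by (auto intro!: rational_fps_sum)
  qed
qed

text \<open>
  The refinement identity, with \<open>J\<close> as the larger set and \<open>R\<close> in both places of the smaller one, is a linear
  system for the series \<open>h(L;R,J,K)\<close>, \<open>R \<subseteq> J\<close>. The matrix entry \<open>h(J;a,a,b)\<close> vanishes unless \<open>|a| = |b|\<close>,
  so the hypothesis covers all entries, and its constant term is \<open>1\<close> if \<open>a = b\<close> and \<open>0\<close> otherwise.
\<close>

lemma rational_h_of_balanced:
  assumes S: "finite S"
    and bal: "\<And>L J K. \<lbrakk>L \<subseteq> S; J \<subseteq> L; K \<subseteq> L; card J = card K\<rbrakk> \<Longrightarrow>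
      rational_fps (poincare W S (h_set W S L J J K))"
    and sub: "L \<subseteq> S" "J \<subseteq> L" "K \<subseteq> L" "R \<subseteq> J"
  shows "rational_fps (poincare W S (h_set W S L R J K))"
proof -
  have bal': "rational_fps (poincare W S (h_set W S L J J K))" if "L \<subseteq> S" "J \<subseteq> L" "K \<subseteq> L" for L J K
    using bal[OF that] that h_set_empty[of L K J J] by (cases "card J = card K") auto
  have JK: "J \<subseteq> S" "K \<subseteq> S" using sub by auto
  have "\<forall>R\<in>Pow J. rational_fps (poincare W S (h_set W S L R J K))"
  proof (rule rational_fps_linear_system[where
        M = "\<lambda>a b. poincare W S (h_set W S J a a b)" and y = "\<lambda>a. poincare W S (h_set W S L a a K)"])
    show "finite (Pow J)" using S JK by (simp add: finite_subset)
    show "rational_fps (poincare W S (h_set W S J a a b))" if "a \<in> Pow J" "b \<in> Pow J" for a b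
      using that JK by (intro bal') auto
    show "rational_fps (poincare W S (h_set W S L a a K))" if "a \<in> Pow J" for a
      using that sub by (intro bal') auto
    have nth: "poincare W S (h_set W S J a a b) $ 0 = (if b = a then 1 else 0)"
      if "a \<in> Pow J" "b \<in> Pow J" for a b
      using that JK by (subst poincare_nth_0) (auto simp: one_in_h_set h_set_carrier)
    show "poincare W S (h_set W S J a a a) $ 0 = 1" if "a \<in> Pow J" for a
      using nth that by simp
    show "a \<le> b" if "a \<in> Pow J" "b \<in> Pow J" "poincare W S (h_set W S J a a b) $ 0 \<noteq> 0" for a b
      using nth[OF that(1,2)] that(3) by (auto split: if_splits)
    show "(\<Sum>b\<in>Pow J. poincare W S (h_set W S J a a b) * poincare W S (h_set W S L b J K)) =
        poincare W S (h_set W S L a a K)" if "a \<in> Pow J" for a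
      using poincare_h_set_refine[OF S order_refl _ sub(2,1) JK(2), of a] that by (simp add: mult.commute)
  qed
  thus ?thesis using sub by blast
qed

lemma poincare_p_diag_sum_h:
  assumes S: "finite S" and sub: "L \<subseteq> S" "J \<subseteq> S" "K \<subseteq> S"
  shows "poincare W S (p_set W S L K J K) = (\<Sum>R\<in>Pow J. poincare W S (h_set W S L R J K))"
proof -
  have "K \<inter> conj_set W (inv x) J = K \<longleftrightarrow> conj_set W x K \<subseteq> J" if x: "x \<in> carrier W" for x
  proof -
    have "conj_set W x (conj_set W (inv x) J) = J" "conj_set W (inv x) (conj_set W x K) = K"
      using conj_set_mult[of x "inv x" J] conj_set_mult[of "inv x" x K] x sub
      by (simp_all add: conj_set_one)
    moreover have "conj_set W y A \<subseteq> conj_set W y B" if "A \<subseteq> B" for A B y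
      using that by (auto simp: conj_set_def)
    ultimately show ?thesis by (metis inf.absorb_iff1)
  qed
  hence "x \<in> double_reps W S L J K \<Longrightarrow> K \<inter> conj_set W (inv x) J = K \<longleftrightarrow> conj_set W x K \<subseteq> J" for x
    using double_reps_carrier[OF sub(1)] by blast
  hence "p_set W S L K J K = (\<Union>R\<in>Pow J. h_set W S L R J K)"
    by (intro Set.set_eqI) (simp add: p_set_def h_set_def Bex_def cong: conj_cong)
  moreover have "poincare W S (\<Union>R\<in>Pow J. h_set W S L R J K) =
      (\<Sum>R\<in>Pow J. poincare W S (h_set W S L R J K))"
  proof (rule poincare_disjoint_UN[OF S])
    show "finite (Pow J)" using finite_subset[OF sub(2) S] by simp
    show "h_set W S L R J K \<subseteq> carrier W" for R using h_set_carrier[OF sub(1)] .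
  qed (simp add: h_set_def disjoint_iff)
  ultimately show ?thesis by simp
qed

lemma poincare_double_reps_sum_p:
  assumes S: "finite S" and sub: "L \<subseteq> S" "K \<subseteq> S"
  shows "poincare W S (double_reps W S L J K) = (\<Sum>Q\<in>Pow K. poincare W S (p_set W S L Q J K))"
proof -
  have "double_reps W S L J K = (\<Union>Q\<in>Pow K. p_set W S L Q J K)"
    by (rule Set.set_eqI) (simp add: p_set_def Bex_def)
  moreover have "poincare W S (\<Union>Q\<in>Pow K. p_set W S L Q J K) =
      (\<Sum>Q\<in>Pow K. poincare W S (p_set W S L Q J K))"
  proof (rule poincare_disjoint_UN[OF S])
    show "finite (Pow K)" using finite_subset[OF sub(2) S] by simp
    show "p_set W S L Q J K \<subseteq> carrier W" for Q using p_set_carrier[OF sub(1)] .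
  qed (simp add: p_set_def disjoint_iff)
  ultimately show ?thesis by simp
qed

section \<open>Parabolic subgroups of finite index\<close>

lemma gen_commutes:
  assumes "C \<subseteq> S" "r \<in> carrier W" "\<And>c. c \<in> C \<Longrightarrow> c \<otimes> r = r \<otimes> c" "h \<in> gen C"
  shows "h \<otimes> r = r \<otimes> h"
proof -
  have "ev ws \<otimes> r = r \<otimes> ev ws" if "ws \<in> lists C" for ws
    using that
  proof (induction ws rule: list.induct)
    case (Cons c ws)
    have C: "c \<in> C" "ws \<in> lists C" using Cons.prems by simp_all
    hence S: "c \<in> S" "ws \<in> lists S" using assms(1) lists_subset[OF assms(1)] by auto
    have "c \<otimes> ev ws \<otimes> r = c \<otimes> (r \<otimes> ev ws)" using Cons.IH[OF C(2)] S assms(2) by (simp add: m_assoc)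
    also have "\<dots> = r \<otimes> c \<otimes> ev ws" using assms(3)[OF C(1)] S assms(2) by (simp flip: m_assoc)
    finally show ?case using S assms(2) by (simp add: m_assoc)
  qed (use assms(2) in simp)
  thus ?thesis using gen_word[OF assms(1,4)] by auto
qed

lemma len_outside_gen:
  assumes "E \<subseteq> S" "r \<in> S" "r \<notin> E" "g \<in> gen E"
  shows "ell (r \<otimes> g) = ell g + 1" "ell (g \<otimes> r) = ell g + 1"
proof -
  have r: "r \<in> min_right E"
    unfolding min_right_def
  proof (intro CollectI conjI ballI)
    fix k assume k: "k \<in> E"
    hence kS: "k \<in> S" using assms by auto
    have "r \<otimes> k \<noteq> \<one>"
    proof
      assume "r \<otimes> k = \<one>"
      hence "r \<otimes> k \<otimes> k = k" using kS by simp
      thus False using k kS assms by (simp add: m_assoc)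
    qed
    hence "ell (r \<otimes> k) \<noteq> 0" using len_eq_0 kS assms by simp
    thus "ell r < ell (r \<otimes> k)" using len_mult_gen[of r k] kS assms len_gen by auto
  qed (use assms in auto)
  have add: "ell (r \<otimes> h) = ell h + 1" if "h \<in> gen E" for h
    using min_right_len_add[OF assms(1) r that] len_gen assms by simp
  show "ell (r \<otimes> g) = ell g + 1" using add assms by blast
  have "g \<in> carrier W" using assms gen_in_carrier by blast
  thus "ell (g \<otimes> r) = ell g + 1"
    using len_inv[of "g \<otimes> r"] add[OF gen_closed(3)[OF assms(1,4)]] assms by (simp add: inv_mult_group)
qed

text \<open>
  A special case of Kilmoyer's theorem on intersections of parabolic subgroups. With \<open>h' = r h r\<close>, the
  element \<open>r h = h' r\<close> has every right descent \<open>q\<close> of \<open>h\<close> as a right descent, which by exchange makes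
  \<open>r (h q) r\<close> an element of \<open>W\<^sub>E\<close> too. By induction the letters of \<open>h q\<close> commute with \<open>r\<close>, and then \<open>r q r\<close>
  is an element of \<open>W\<^sub>E\<close> of length one, which must be \<open>q\<close>.
\<close>

lemma gen_inter_conj_gen:
  assumes E: "E \<subseteq> S" and r: "r \<in> S" "r \<notin> E"
    and h: "h \<in> gen E" "r \<otimes> h \<otimes> r \<in> gen E"
  shows "h \<in> gen {q \<in> E. q \<otimes> r = r \<otimes> q}"
  using h
proof (induction "ell h" arbitrary: h rule: less_induct)
  case less
  define C where "C = {q \<in> E. q \<otimes> r = r \<otimes> q}"
  have C: "C \<subseteq> S" "C \<subseteq> E" using E by (auto simp: C_def)
  define h' where "h' = r \<otimes> h \<otimes> r"
  have hc: "h \<in> carrier W" "h' \<in> carrier W" using less.prems gen_in_carrier E by (auto simp: h'_def)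
  have h': "h' \<in> gen E" using less.prems by (simp add: h'_def)
  have rh: "r \<otimes> h = h' \<otimes> r" using hc r by (simp add: h'_def m_assoc)
  show ?case
  proof (cases "h = \<one>")
    case True
    thus ?thesis using generate.one by simp
  next
    case False
    then obtain q where q: "q \<in> E" "ell h = ell (h \<otimes> q) + 1" "h \<otimes> q \<in> gen E"
      using ex_right_descent[OF E less.prems(1)] by blast
    define h1 where "h1 = h \<otimes> q"
    have qS: "q \<in> S" "q \<noteq> r" using q E r by auto
    have h1: "h1 \<in> gen E" "h1 \<in> carrier W" "h = h1 \<otimes> q" "ell h = ell h1 + 1"
      using q hc qS by (auto simp: h1_def m_assoc)
    have "h' \<otimes> r \<otimes> q = r \<otimes> h1" using hc qS r unfolding rh[symmetric] h1_def by (simp add: m_assoc)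
    hence "ell (h' \<otimes> r \<otimes> q) < ell (h' \<otimes> r)"
      using len_outside_gen(1)[OF E r h1(1)] len_outside_gen(1)[OF E r less.prems(1)] h1(4) rh by simp
    moreover obtain ws where ws: "ws \<in> lists E" "ev ws = h'" using gen_word[OF E h'] by blast
    moreover have wsS: "ws \<in> lists S" using ws E lists_subset by blast
    moreover have e: "ev (ws @ [r]) = h' \<otimes> r" using wsS ws r by simp
    ultimately obtain us s vs where d: "ws @ [r] = us @ s # vs" "ev (ws @ [r]) \<otimes> q = ev (us @ vs)"
      using strong_exchange[of "ws @ [r]" q] reflection_gen qS r by auto
    \<comment> \<open>the deleted letter is not the last one, so the shorter word still ends in r\<close>
    have "\<exists>vs'. ws = us @ s # vs' \<and> vs = vs' @ [r]"
    proof (cases vs rule: rev_cases)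
      case Nil
      hence "ws = us" using d by simp
      hence "h' \<otimes> r \<otimes> q = h'" using d(2) e ws Nil by simp
      hence "h' \<otimes> (r \<otimes> q) = h' \<otimes> \<one>" using hc r qS by (simp add: m_assoc)
      hence "r \<otimes> q = \<one>" using hc r qS by simp
      hence "inv q = r" using r qS by (intro inv_equality) auto
      hence "r = q" using qS by simp
      thus ?thesis using qS by simp
    qed (use d in auto)
    then obtain vs' where vs': "ws = us @ s # vs'" "vs = vs' @ [r]" by blast
    define h2 where "h2 = ev (us @ vs')"
    have in_E: "us @ vs' \<in> lists E" using vs' ws by auto
    hence in_S: "us \<in> lists S" "vs' \<in> lists S" using lists_subset[OF E] by auto
    have h2: "h2 \<in> gen E" "h2 \<in> carrier W" using ev_in_gen[OF E in_E] gen_in_carrier E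
      by (auto simp: h2_def)
    have "r \<otimes> h1 = h2 \<otimes> r"
      using d(2) e vs' in_S r \<open>h' \<otimes> r \<otimes> q = r \<otimes> h1\<close> by (simp add: h2_def m_assoc)
    hence "r \<otimes> h1 \<otimes> r = h2" using h2 r h1 by (simp add: m_assoc)
    hence h1C: "h1 \<in> gen C" using less.hyps[of h1] h1 h2 unfolding C_def by simp
    have h1r: "h1 \<otimes> r = r \<otimes> h1" using gen_commutes[OF C(1) _ _ h1C] r by (auto simp: C_def)
    define g where "g = r \<otimes> q \<otimes> r"
    have "h1 \<otimes> g = h1 \<otimes> r \<otimes> q \<otimes> r" using h1 r qS by (simp add: g_def m_assoc)
    also have "\<dots> = h'" unfolding h1r using h1 r qS by (simp add: h'_def m_assoc)
    finally have "inv h1 \<otimes> (h1 \<otimes> g) = inv h1 \<otimes> h'" by simp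
    hence "g = inv h1 \<otimes> h'" using h1(2) r qS by (simp add: g_def)
    hence gE: "g \<in> gen E" using gen_closed[OF E] h1 h' by blast
    have gc: "g \<in> carrier W" using r qS by (simp add: g_def)
    have "r \<otimes> q = g \<otimes> r" using r qS by (simp add: g_def m_assoc)
    hence "ell g = 1"
      using len_outside_gen(1)[OF E r gen_closed(4)[OF E q(1)]] len_outside_gen(2)[OF E r gE] len_gen[OF qS(1)]
      by simp
    hence "g \<in> E" using gen_len_one E gE by blast
    have "q = r \<otimes> g \<otimes> r" using r qS by (simp add: g_def m_assoc)
    moreover have gr: "{g, r} \<subseteq> S" using \<open>g \<in> E\<close> E r by auto
    moreover have "g \<in> gen {g, r}" "r \<in> gen {g, r}" using gen_closed(4)[OF gr] by simp_all
    ultimately have "q \<in> gen {g, r}" using gen_closed(2)[OF gr] by metis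
    hence "q \<in> {g, r}" using gen_len_one[OF gr] len_gen qS by blast
    hence "q = g" using qS by simp
    hence "q \<otimes> r = r \<otimes> q" using \<open>r \<otimes> q = g \<otimes> r\<close> by simp
    hence "q \<in> gen C" using q gen_closed(4)[OF C(1)] by (auto simp: C_def)
    thus ?thesis using gen_closed(2)[OF C(1) h1C] h1(3) unfolding C_def by simp
  qed
qed

text \<open>
  Connectedness of the Coxeter graph on \<open>I\<close>; under this definition the empty set is irreducible.
\<close>

definition irreducible_gens :: "'a set \<Rightarrow> bool" where
  "irreducible_gens I \<longleftrightarrow>
     (\<forall>A \<subseteq> I. A \<noteq> {} \<longrightarrow> A \<noteq> I \<longrightarrow> (\<exists>a\<in>A. \<exists>b\<in>I - A. a \<otimes> b \<noteq> b \<otimes> a))"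

lemma gen_empty: "gen {} = {\<one>}"
  by (rule generate_empty)

text \<open>
  Let \<open>E \<subseteq> L\<close> be smallest such that \<open>W\<^sub>E\<close> contains the core \<open>N\<close> of \<open>W\<^sub>L\<close> in \<open>W\<^sub>I\<close>. If \<open>E\<close> were nonempty,
  connectedness would give \<open>a \<in> E\<close> and \<open>b \<in> I - E\<close> that do not commute. As \<open>N\<close> is normal,
  \<open>N \<subseteq> W\<^sub>E \<inter> b W\<^sub>E b\<close>, and \<open>gen_inter_conj_gen\<close> places \<open>N\<close> in a parabolic subgroup whose generators
  omit \<open>a\<close>.
\<close>

lemma parabolic_core_trivial:
  assumes I: "finite I" "I \<subseteq> S" "irreducible_gens I" and L: "L \<subseteq> I" "L \<noteq> I"
    and n: "n \<in> carrier W" "\<And>w. w \<in> gen I \<Longrightarrow> w \<otimes> n \<otimes> inv w \<in> gen L"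
  shows "n = \<one>"
proof -
  define N where "N = {n \<in> carrier W. \<forall>w\<in>gen I. w \<otimes> n \<otimes> inv w \<in> gen L}"
  have "N \<subseteq> gen L"
  proof
    fix n assume n: "n \<in> N"
    hence "\<one> \<otimes> n \<otimes> inv \<one> \<in> gen L" using generate.one unfolding N_def by blast
    thus "n \<in> gen L" using n by (simp add: N_def)
  qed
  define P where "P E \<longleftrightarrow> E \<subseteq> L \<and> N \<subseteq> gen E" for E
  have "P L" using \<open>N \<subseteq> gen L\<close> by (simp add: P_def)
  then obtain E where E: "P E" "\<And>F. P F \<Longrightarrow> card E \<le> card F"
    using ex_has_least_nat[of P L card] by blast
  have EI: "E \<subseteq> I" "E \<noteq> I" "E \<subseteq> S" "finite E"
    using E L I(2) finite_subset[OF _ I(1), of E] by (auto simp: P_def)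
  have "E = {}"
  proof (rule ccontr)
    assume "E \<noteq> {}"
    then obtain a b where ab: "a \<in> E" "b \<in> I - E" "a \<otimes> b \<noteq> b \<otimes> a"
      using I(3) EI(1,2) unfolding irreducible_gens_def by blast
    have b: "b \<in> S" "b \<notin> E" "b \<in> gen I" using ab I(2) gen_closed(4)[OF I(2), of b] by auto
    have "N \<subseteq> gen {q \<in> E. q \<otimes> b = b \<otimes> q}"
    proof
      fix n assume n: "n \<in> N"
      have nc: "n \<in> carrier W" using n by (simp add: N_def)
      have "b \<otimes> n \<otimes> b \<in> N" unfolding N_def
      proof (intro CollectI conjI ballI)
        fix w assume w: "w \<in> gen I"
        hence wc: "w \<in> carrier W" using gen_in_carrier I by blast
        have "w \<otimes> (b \<otimes> n \<otimes> b) \<otimes> inv w = (w \<otimes> b) \<otimes> n \<otimes> inv (w \<otimes> b)"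
          using wc nc b by (simp add: m_assoc inv_mult_group)
        thus "w \<otimes> (b \<otimes> n \<otimes> b) \<otimes> inv w \<in> gen L"
          using n gen_closed(2)[OF I(2) w b(3)] by (simp add: N_def)
      qed (use nc b in simp)
      thus "n \<in> gen {q \<in> E. q \<otimes> b = b \<otimes> q}"
        using n E(1) by (intro gen_inter_conj_gen[OF EI(3) b(1,2)]) (auto simp: P_def)
    qed
    hence "P {q \<in> E. q \<otimes> b = b \<otimes> q}" using E(1) by (auto simp: P_def)
    hence "card E \<le> card {q \<in> E. q \<otimes> b = b \<otimes> q}" using E by blast
    moreover have "{q \<in> E. q \<otimes> b = b \<otimes> q} \<subset> E" using ab by blast
    from psubset_card_mono[OF EI(4) this] have "card {q \<in> E. q \<otimes> b = b \<otimes> q} < card E" .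
    ultimately show False by simp
  qed
  moreover have "n \<in> N" using n by (simp add: N_def)
  ultimately show ?thesis using E(1) gen_empty by (auto simp: P_def)
qed

text \<open>
  The permutation action of \<open>W\<^sub>I\<close> on the finite set of cosets of \<open>W\<^sub>L\<close> is faithful, since its kernel is the
  core of \<open>W\<^sub>L\<close>. The finite set \<open>B\<close> contains representatives of all cosets.
\<close>

lemma finite_gen_of_finite_index:
  assumes I: "finite I" "I \<subseteq> S" "irreducible_gens I" and L: "L \<subseteq> I" "L \<noteq> I"
    and B: "finite B" "B \<subseteq> gen I"
    and cover: "\<And>w. w \<in> gen I \<Longrightarrow> \<exists>b\<in>B. inv b \<otimes> w \<in> gen L"
  shows "finite (gen I)"
proof -
  have LS: "L \<subseteq> S" using L I by auto
  \<comment> \<open>the action on coset representatives; \<open>\<phi> g f\<close> represents the coset of \<open>g f\<close>\<close>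
  define \<phi> where "\<phi> g = restrict (\<lambda>f. SOME b. b \<in> B \<and> inv b \<otimes> (g \<otimes> f) \<in> gen L) B" for g
  have \<phi>: "\<phi> g f \<in> B \<and> inv (\<phi> g f) \<otimes> (g \<otimes> f) \<in> gen L" if "g \<in> gen I" "f \<in> B" for g f
  proof -
    have "g \<otimes> f \<in> gen I" using that B gen_closed(2)[OF I(2)] by blast
    hence "\<exists>b. b \<in> B \<and> inv b \<otimes> (g \<otimes> f) \<in> gen L" using cover by blast
    from someI_ex[OF this] show ?thesis using that by (simp add: \<phi>_def)
  qed
  have "\<phi> ` gen I \<subseteq> B \<rightarrow>\<^sub>E B" using \<phi> by (auto simp: \<phi>_def)
  hence "finite (\<phi> ` gen I)" using B finite_PiE[of B "\<lambda>_. B"] finite_subset by blast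
  moreover have "inj_on \<phi> (gen I)"
  proof (rule inj_onI)
    fix g h assume gh: "g \<in> gen I" "h \<in> gen I" "\<phi> g = \<phi> h"
    have c: "g \<in> carrier W" "h \<in> carrier W" using gh gen_in_carrier I by auto
    define n where "n = inv g \<otimes> h"
    have nc: "n \<in> carrier W" using c by (simp add: n_def)
    have B_conj: "inv f \<otimes> n \<otimes> f \<in> gen L" if f: "f \<in> B" for f
    proof -
      define b where "b = \<phi> g f"
      have b: "b \<in> B" "inv b \<otimes> (g \<otimes> f) \<in> gen L" "inv b \<otimes> (h \<otimes> f) \<in> gen L"
        using \<phi>[OF gh(1) f] \<phi>[OF gh(2) f] gh(3) by (auto simp: b_def)
      have fc: "f \<in> carrier W" "b \<in> carrier W" using f b B gen_in_carrier[OF I(2)] by auto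
      have "inv (inv b \<otimes> (g \<otimes> f)) \<otimes> (inv b \<otimes> (h \<otimes> f)) = inv f \<otimes> n \<otimes> f"
        using fc c by (simp add: n_def m_assoc inv_mult_group)
      thus ?thesis using gen_closed(2)[OF LS gen_closed(3)[OF LS b(2)] b(3)] by simp
    qed
    have "n = \<one>"
    proof (rule parabolic_core_trivial[OF I L nc])
      fix w assume w: "w \<in> gen I"
      hence wc: "w \<in> carrier W" using gen_in_carrier I by blast
      obtain f where f: "f \<in> B" "inv f \<otimes> inv w \<in> gen L" using cover[OF gen_closed(3)[OF I(2) w]] by blast
      have fc: "f \<in> carrier W" using f B gen_in_carrier[OF I(2)] by auto
      have "inv (inv f \<otimes> inv w) \<otimes> (inv f \<otimes> n \<otimes> f) \<otimes> (inv f \<otimes> inv w) = w \<otimes> n \<otimes> inv w"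
        using fc wc nc by (simp add: m_assoc inv_mult_group)
      thus "w \<otimes> n \<otimes> inv w \<in> gen L"
        using gen_closed(2)[OF LS gen_closed(2)[OF LS gen_closed(3)[OF LS f(2)] B_conj[OF f(1)]] f(2)] by simp
    qed
    hence "g \<otimes> (inv g \<otimes> h) = g" using c by (simp add: n_def)
    thus "g = h" using c by simp
  qed
  ultimately show ?thesis by (rule finite_imageD)
qed

section \<open>Conjugation of infinite irreducible generating sets\<close>

text \<open>
  The reflexive transitive closure is the Bruhat order.
\<close>

definition bruhat_step :: "'a \<Rightarrow> 'a \<Rightarrow> bool" where
  "bruhat_step u w \<longleftrightarrow> w \<in> carrier W \<and> (\<exists>t. reflection t \<and> u = w \<otimes> t \<and> ell u < ell w)"

text \<open>
  For \<open>u = w t\<close>: if \<open>s u\<close> is not below \<open>s w\<close>, then \<open>t\<close> is an inversion of \<open>s u\<close> but not of \<open>u\<close>, so it is the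
  reflection attached to the letter \<open>s\<close>, that is, \<open>s u = u t\<close>.
\<close>

lemma bruhat_step_left:
  assumes "bruhat_step u w" "s \<in> S"
  shows "s \<otimes> u = w \<or> bruhat_step (s \<otimes> u) (s \<otimes> w)"
proof -
  obtain t where t: "reflection t" "u = w \<otimes> t" "ell u < ell w" and w: "w \<in> carrier W"
    using assms by (auto simp: bruhat_step_def)
  have tc: "t \<in> carrier W" "t \<otimes> t = \<one>" using reflectionD t by auto
  have u: "u \<in> carrier W" "u \<otimes> t = w" using t w tc by (auto simp: m_assoc)
  show ?thesis
  proof (cases "ell (s \<otimes> u) < ell (s \<otimes> w)")
    case True
    moreover have "s \<otimes> u = s \<otimes> w \<otimes> t" using t w tc assms by (simp add: m_assoc)
    ultimately show ?thesis using t w assms unfolding bruhat_step_def by auto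
  next
    case False
    obtain us where us: "us \<in> lists S" "ev us = u" using ex_reduced_word u by blast
    have "\<not> par us t" using len_reflection_iff(1)[OF us(1) t(1)] us u t(3) by simp
    moreover have "par (s # us) t"
    proof -
      have e: "ev (s # us) \<otimes> t = s \<otimes> w" "ev (s # us) = s \<otimes> u" using us u tc assms by (auto simp: m_assoc)
      have S: "s # us \<in> lists S" using us assms by simp
      have "ell (s \<otimes> w) < ell (s \<otimes> u)" using len_reflection_iff(2)[OF S t(1)] False unfolding e(1) unfolding e(2) by linarith
      thus ?thesis using len_reflection_iff(1)[OF S t(1)] unfolding e(1) unfolding e(2) by simp
    qed
    ultimately show ?thesis using us u by simp
  qed
qed

lemma bruhat_lift:
  assumes "bruhat_step\<^sup>*\<^sup>* w z" "s \<in> S"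
  shows "bruhat_step\<^sup>*\<^sup>* (s \<otimes> w) z \<or> bruhat_step\<^sup>*\<^sup>* (s \<otimes> w) (s \<otimes> z)"
  using assms(1)
proof (induction rule: converse_rtranclp_induct)
  case (step w w1)
  from bruhat_step_left[OF step(1) assms(2)] show ?case
  proof
    assume "s \<otimes> w = w1"
    thus ?thesis using step by simp
  next
    assume "bruhat_step (s \<otimes> w) (s \<otimes> w1)"
    thus ?thesis using step.IH by (meson converse_rtranclp_into_rtranclp)
  qed
qed simp

text \<open>
  The set of elements below some element of \<open>v W\<^sub>L\<close> contains \<open>v\<close> and is stable under left multiplication
  by \<open>I\<close>. By lifting it suffices to consider \<open>i v x\<close>: for \<open>i \<noteq> d\<close> this is again in \<open>v W\<^sub>L\<close>, and for
  \<open>i = d\<close> it lies below \<open>v x\<close>.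
\<close>

lemma bruhat_below_coset:
  assumes I: "I \<subseteq> S" and L: "L \<subseteq> I" and v: "v \<in> gen I" "v \<in> min_right L"
    and d: "d \<in> I" "ell (d \<otimes> v) < ell v"
    and stab: "\<And>i. \<lbrakk>i \<in> I; i \<noteq> d\<rbrakk> \<Longrightarrow> \<exists>r\<in>L. i \<otimes> v = v \<otimes> r"
    and w: "w \<in> gen I"
  shows "\<exists>x\<in>gen L. bruhat_step\<^sup>*\<^sup>* w (v \<otimes> x)"
proof -
  have LS: "L \<subseteq> S" and vc: "v \<in> carrier W" using L I v gen_in_carrier by auto
  have "\<exists>x\<in>gen L. bruhat_step\<^sup>*\<^sup>* (ev ws \<otimes> v) (v \<otimes> x)" if "ws \<in> lists I" for ws
    using that
  proof (induction ws rule: list.induct)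
    case Nil
    show ?case using vc by (intro bexI[of _ \<one>]) (auto intro: generate.one)
  next
    case (Cons i ws)
    then obtain x where x: "x \<in> gen L" "bruhat_step\<^sup>*\<^sup>* (ev ws \<otimes> v) (v \<otimes> x)" by auto
    have iI: "i \<in> I" "ws \<in> lists I" using Cons.prems by simp_all
    hence S: "i \<in> S" "i \<in> I" "ws \<in> lists S" using I lists_subset[OF I] by auto
    have xc: "x \<in> carrier W" using x LS gen_in_carrier by blast
    have e: "ev (i # ws) \<otimes> v = i \<otimes> (ev ws \<otimes> v)" using S vc by (simp add: m_assoc)
    from bruhat_lift[OF x(2) S(1)] show ?case
    proof
      assume "bruhat_step\<^sup>*\<^sup>* (i \<otimes> (ev ws \<otimes> v)) (v \<otimes> x)"
      thus ?thesis using x e by auto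
    next
      assume b: "bruhat_step\<^sup>*\<^sup>* (i \<otimes> (ev ws \<otimes> v)) (i \<otimes> (v \<otimes> x))"
      show ?thesis
      proof (cases "i = d")
        case True
        have "bruhat_step (d \<otimes> (v \<otimes> x)) (v \<otimes> x)"
          unfolding bruhat_step_def
        proof (intro conjI exI)
          show "reflection (inv (v \<otimes> x) \<otimes> d \<otimes> inv (inv (v \<otimes> x)))"
            using reflection_conj[OF reflection_gen, of d "inv (v \<otimes> x)"] S True vc xc by simp
          show "d \<otimes> (v \<otimes> x) = v \<otimes> x \<otimes> (inv (v \<otimes> x) \<otimes> d \<otimes> inv (inv (v \<otimes> x)))"
            using S True vc xc by (simp add: m_assoc inv_mult_group)
          have "ell (d \<otimes> v \<otimes> x) \<le> ell (d \<otimes> v) + ell x" using len_mult_le[of "d \<otimes> v" x] S True vc xc by simp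
          also have "\<dots> < ell v + ell x" using d by simp
          also have "\<dots> = ell (v \<otimes> x)" using min_right_len_add[OF LS v(2) x(1)] by simp
          finally show "ell (d \<otimes> (v \<otimes> x)) < ell (v \<otimes> x)" using S True vc xc by (simp add: m_assoc)
        qed (use vc xc in simp)
        thus ?thesis using b x e True by (metis rtranclp.rtrancl_into_rtrancl)
      next
        case False
        then obtain r where r: "r \<in> L" "i \<otimes> v = v \<otimes> r" using stab S by blast
        have rS: "r \<in> S" using r LS by auto
        have "i \<otimes> (v \<otimes> x) = i \<otimes> v \<otimes> x" using S vc xc by (simp add: m_assoc)
        also have "\<dots> = v \<otimes> (r \<otimes> x)" using r rS vc xc by (simp add: m_assoc)
        finally have "bruhat_step\<^sup>*\<^sup>* (ev (i # ws) \<otimes> v) (v \<otimes> (r \<otimes> x))" using b e by simp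
        thus ?thesis using gen_closed(2)[OF LS gen_closed(4)[OF LS r(1)] x(1)] by blast
      qed
    qed
  qed
  moreover have "w \<otimes> inv v \<in> gen I" using w v gen_closed[OF I] by blast
  then obtain ws where "ws \<in> lists I" "ev ws = w \<otimes> inv v" using gen_word[OF I] by blast
  moreover have "w \<otimes> inv v \<otimes> v = w" using w vc gen_in_carrier I by (simp add: m_assoc)
  ultimately show ?thesis by metis
qed

text \<open>
  Each step down deletes a letter, either from the word \<open>as\<close> or from a word for the factor in \<open>W\<^sub>L\<close>. So
  only boundedly many first factors occur, and an element below \<open>v W\<^sub>L\<close> lies in one of finitely
  many cosets of \<open>W\<^sub>L\<close>.
\<close>

lemma bruhat_subword:
  assumes "bruhat_step\<^sup>*\<^sup>* u z" "I \<subseteq> S" "L \<subseteq> S" "as \<in> lists I" "z = ev as \<otimes> g" "g \<in> gen L"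
  shows "\<exists>bs \<in> lists I. length bs \<le> length as \<and> (\<exists>h\<in>gen L. u = ev bs \<otimes> h)"
  using assms(1)
proof (induction rule: converse_rtranclp_induct)
  case base
  show ?case using assms by blast
next
  case (step u w)
  then obtain bs h where bs: "bs \<in> lists I" "length bs \<le> length as" "h \<in> gen L" "w = ev bs \<otimes> h" by blast
  obtain hs where hs: "hs \<in> lists L" "ev hs = h" using gen_word[OF assms(3) bs(3)] by blast
  have S: "bs \<in> lists S" "hs \<in> lists S" using bs hs assms lists_subset by auto
  obtain t where t: "reflection t" "u = w \<otimes> t" "ell u < ell w" using step by (auto simp: bruhat_step_def)
  have w: "ev (bs @ hs) = w" using S bs hs by simp
  obtain us s vs where d: "bs @ hs = us @ s # vs" "u = ev (us @ vs)"
  proof (rule strong_exchange[of "bs @ hs" t])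
    show "bs @ hs \<in> lists S" using S by simp
  qed (use t w in simp_all)
  from append_eq_middle[OF d(1)] show ?case
  proof (elim disjE exE conjE)
    fix vs' assume *: "bs = us @ s # vs'" "vs = vs' @ hs"
    hence "us @ vs' \<in> lists I" "length (us @ vs') \<le> length as" using bs by auto
    moreover have "u = ev (us @ vs') \<otimes> h"
      using d(2) * S hs gen_in_carrier[OF assms(3) bs(3)] by (simp add: m_assoc)
    ultimately show ?thesis using bs(3) by blast
  next
    fix us' assume *: "hs = us' @ s # vs" "us = bs @ us'"
    hence "us' @ vs \<in> lists L" using hs by auto
    hence "ev (us' @ vs) \<in> gen L" using ev_in_gen assms(3) by blast
    moreover have "u = ev bs \<otimes> ev (us' @ vs)" using d(2) * S by (simp add: m_assoc)
    ultimately show ?thesis using bs by blast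
  qed
qed

text \<open>
  A left descent \<open>d\<close> of \<open>v\<close> cannot lie in \<open>v L v\<^sup>-\<^sup>1\<close>, because \<open>v\<close> is minimal in \<open>v W\<^sub>L\<close>. By cardinality
  \<open>v L v\<^sup>-\<^sup>1 = I - {d}\<close>, which is the situation of \<open>bruhat_below_coset\<close>.
\<close>

lemma finite_gen_of_conj_maximal:
  assumes I: "finite I" "I \<subseteq> S" "irreducible_gens I" and s: "s \<in> I" "L = I - {s}"
    and v: "v \<in> gen I" "v \<in> min_right L" "v \<noteq> \<one>" and conj: "conj_set W v L \<subseteq> I"
  shows "finite (gen I)"
proof -
  have L: "L \<subseteq> I" "L \<subseteq> S" "L \<noteq> I" using s I by auto
  have vc: "v \<in> carrier W" using v by (simp add: min_right_def)
  obtain d where d: "d \<in> I" "ell v = ell (d \<otimes> v) + 1" using ex_left_descent[OF I(2) v(1,3)] by blast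
  have "conj_set W v L \<subseteq> I - {d}"
  proof -
    have "d \<notin> conj_set W v L"
    proof
      assume "d \<in> conj_set W v L"
      moreover have "d \<in> carrier W" using d(1) I(2) by auto
      ultimately obtain r where "r \<in> L" "d \<otimes> v = v \<otimes> r"
        using mem_conj_set[OF vc L(2)] by blast
      thus False using v(2) d by (auto simp: min_right_def)
    qed
    thus ?thesis using conj by blast
  qed
  moreover have "card (conj_set W v L) = card (I - {d})"
    using card_conj_set[OF vc L(2)] s d I by simp
  ultimately have eq: "conj_set W v L = I - {d}" using I(1) by (simp add: card_subset_eq)
  have stab: "\<exists>r\<in>L. i \<otimes> v = v \<otimes> r" if "i \<in> I" "i \<noteq> d" for i
    using that eq mem_conj_set[of v L i] vc L I by auto
  obtain vs where vs: "vs \<in> lists I" "ev vs = v" using gen_word[OF I(2) v(1)] by blast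
  define B where "B = ev ` {bs \<in> lists I. length bs \<le> length vs}"
  have "finite {bs \<in> lists I. length bs \<le> length vs}"
    using finite_lists_length_le[OF I(1), of "length vs"] by (simp add: in_lists_conv_set subset_iff Ball_def)
  hence "finite B" by (simp add: B_def)
  moreover have "B \<subseteq> gen I" using ev_in_gen[OF I(2)] by (auto simp: B_def)
  moreover have "\<exists>b\<in>B. inv b \<otimes> w \<in> gen L" if w: "w \<in> gen I" for w
  proof -
    have dl: "ell (d \<otimes> v) < ell v" using d by simp
    obtain x where x: "x \<in> gen L" "bruhat_step\<^sup>*\<^sup>* w (v \<otimes> x)"
      using bruhat_below_coset[OF I(2) L(1) v(1,2) d(1) dl stab w] by blast
    obtain bs h where bs: "bs \<in> lists I" "length bs \<le> length vs" "h \<in> gen L" "w = ev bs \<otimes> h"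
      using bruhat_subword[OF x(2) I(2) L(2) vs(1) _ x(1)] vs by auto
    have "ev bs \<in> carrier W" "h \<in> carrier W"
      using bs lists_subset[OF I(2)] gen_in_carrier[OF L(2)] by auto
    hence "inv (ev bs) \<otimes> w = h" using bs by simp
    thus ?thesis using bs by (auto simp: B_def)
  qed
  ultimately show ?thesis using finite_gen_of_finite_index[OF I L(1,3)] by blast
qed

lemma irreducible_insert:
  assumes L: "irreducible_gens L" and r: "r \<in> L" "r \<otimes> s \<noteq> s \<otimes> r"
  shows "irreducible_gens (insert s L)"
  unfolding irreducible_gens_def
proof (intro allI impI)
  fix A assume A: "A \<subseteq> insert s L" "A \<noteq> {}" "A \<noteq> insert s L"
  show "\<exists>a\<in>A. \<exists>b\<in>insert s L - A. a \<otimes> b \<noteq> b \<otimes> a"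
  proof (cases "A \<inter> L = {} \<or> A \<inter> L = L")
    case True
    thus ?thesis
    proof
      assume "A \<inter> L = {}"
      hence "s \<in> A" "r \<notin> A" using A r by auto
      thus ?thesis using r by (intro bexI[of _ s] bexI[of _ r]) auto
    next
      assume "A \<inter> L = L"
      hence "r \<in> A" "s \<notin> A" using A r by auto
      thus ?thesis using r by (intro bexI[of _ r] bexI[of _ s]) auto
    qed
  next
    case False
    then obtain a b where "a \<in> A \<inter> L" "b \<in> L - A \<inter> L" "a \<otimes> b \<noteq> b \<otimes> a"
      using L unfolding irreducible_gens_def by (meson inf_le2)
    thus ?thesis by blast
  qed
qed

lemma min_right_mono: "K \<subseteq> L \<Longrightarrow> min_right L \<subseteq> min_right K"
  by (auto simp: min_right_def)

text \<open>
  Strip off a right descent \<open>s\<close> of \<open>x\<close> and induct on the length. It has to be shown that \<open>s\<close> commutes with \<open>L\<close>.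
  Otherwise \<open>I = L \<union> {s}\<close> is irreducible. Writing \<open>x = y v\<close> with \<open>y\<close> minimal in \<open>y W\<^sub>I\<close> and \<open>v \<in> W\<^sub>I\<close>, Deodhar's
  lemma shows that \<open>v\<close> conjugates \<open>L\<close> into \<open>I\<close>, and \<open>finite_gen_of_conj_maximal\<close> contradicts the
  infinity of \<open>W\<^sub>L\<close>.
\<close>

lemma conj_infinite_irreducible:
  assumes S: "finite S" and G: "G \<subseteq> S" and L: "L \<subseteq> S" "irreducible_gens L" "infinite (gen L)"
    and x: "x \<in> gen G" "x \<in> min_right L" "conj_set W x L \<subseteq> S"
  shows "x \<in> gen {s \<in> G - L. \<forall>r\<in>L. s \<otimes> r = r \<otimes> s}"
  using x
proof (induction "ell x" arbitrary: x rule: less_induct)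
  case less
  define C where "C = {s \<in> G - L. \<forall>r\<in>L. s \<otimes> r = r \<otimes> s}"
  have C: "C \<subseteq> S" using G by (auto simp: C_def)
  have xc: "x \<in> carrier W" using less.prems by (simp add: min_right_def)
  show ?case
  proof (cases "x = \<one>")
    case True
    thus ?thesis using generate.one by simp
  next
    case False
    then obtain s where s: "s \<in> G" "ell x = ell (x \<otimes> s) + 1" "x \<otimes> s \<in> gen G"
      using ex_right_descent[OF G less.prems(1)] by blast
    have sS: "s \<in> S" using s G by auto
    have sL: "s \<notin> L" using s less.prems(2) by (auto simp: min_right_def)
    have xr: "ell x < ell (x \<otimes> r)" if "r \<in> L" for r using less.prems(2) that by (simp add: min_right_def)
    have "\<forall>r\<in>L. s \<otimes> r = r \<otimes> s"
    proof (rule ccontr)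
      assume "\<not> ?thesis"
      then obtain r0 where r0: "r0 \<in> L" "r0 \<otimes> s \<noteq> s \<otimes> r0" by metis
      define I where "I = insert s L"
      have I: "finite I" "I \<subseteq> S" "irreducible_gens I"
        using irreducible_insert[OF L(2) r0] L(1) sS finite_subset[OF _ S] by (auto simp: I_def)
      have xS: "x \<in> gen S" using xc gens_generate by simp
      obtain y v where yv: "y \<in> min_right I" "v \<in> gen I" "x = y \<otimes> v"
        using min_right_decomp[OF I(2) order_refl xS] by blast
      have c: "y \<in> carrier W" "v \<in> carrier W" using yv gen_in_carrier[OF I(2)] by (auto simp: min_right_def)
      have add: "ell (y \<otimes> g) = ell y + ell g" if "g \<in> gen I" for g
        using min_right_len_add[OF I(2) yv(1) that] .
      have genI: "i \<in> gen I" if "i \<in> I" for i using gen_closed(4)[OF I(2) that] .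
      have vi: "ell (x \<otimes> i) = ell y + ell (v \<otimes> i)" if "i \<in> I" for i
      proof -
        have "x \<otimes> i = y \<otimes> (v \<otimes> i)" using yv c that I by (auto simp: m_assoc)
        thus ?thesis using add gen_closed(2)[OF I(2) yv(2) genI[OF that]] by simp
      qed
      have vmin: "v \<in> min_right L"
        using c xr vi add[OF yv(2)] yv(3) by (auto simp: min_right_def I_def)
      have "v \<noteq> \<one>"
      proof
        assume "v = \<one>"
        hence "x = y" using yv c by simp
        thus False using yv(1) s by (auto simp: min_right_def I_def)
      qed
      moreover have "conj_set W v L \<subseteq> I"
      proof
        fix g assume "g \<in> conj_set W v L"
        then obtain r where r: "r \<in> L" "g = v \<otimes> r \<otimes> inv v" by (auto simp: conj_set_def)
        have rS: "r \<in> S" using r L by auto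
        have gv: "g \<otimes> v = v \<otimes> r" and gc: "g \<in> carrier W" using r rS c by (auto simp: m_assoc)
        define j where "j = x \<otimes> r \<otimes> inv x"
        have "j \<in> conj_set W x L" using r by (auto simp: j_def conj_set_def)
        hence j: "j \<in> S" using less.prems by blast
        have jx: "j \<otimes> x = x \<otimes> r" using xc rS by (simp add: j_def m_assoc)
        have jyv: "j \<otimes> y \<otimes> v = y \<otimes> (v \<otimes> r)" using jx yv c j rS by (simp add: m_assoc)
        have "ell (j \<otimes> y) + ell v \<ge> ell (j \<otimes> y \<otimes> v)" using len_mult_le c j by simp
        also have "j \<otimes> y \<otimes> v = x \<otimes> r" using jyv yv c rS by (simp add: m_assoc)
        finally have "ell y < ell (j \<otimes> y)" using xr[OF r(1)] add[OF yv(2)] yv(3) by simp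
        from left_ascent_cases[OF I(2) yv(1) j this] show "g \<in> I"
        proof
          assume "j \<otimes> y \<in> min_right I"
          moreover have "v \<otimes> r \<in> gen I" using gen_closed(2)[OF I(2) yv(2) genI] r by (simp add: I_def)
          ultimately have "v = v \<otimes> r" using min_right_unique[OF I(2) _ yv(1) yv(2) _ jyv] by blast
          hence "ell x = ell (x \<otimes> r)" using yv c rS by (simp add: m_assoc)
          thus ?thesis using xr[OF r(1)] by simp
        next
          assume "\<exists>q\<in>I. j \<otimes> y = y \<otimes> q"
          then obtain q where q: "q \<in> I" "j \<otimes> y = y \<otimes> q" by blast
          have qS: "q \<in> S" using q I by auto
          have "y \<otimes> (q \<otimes> v) = y \<otimes> (v \<otimes> r)" using jyv q qS c by (simp add: m_assoc)
          hence "q \<otimes> v = g \<otimes> v" using gv c qS rS by simp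
          hence "q = g" using c qS gc by simp
          thus ?thesis using q by simp
        qed
      qed
      moreover have "s \<in> I" "L = I - {s}" using sL by (auto simp: I_def)
      ultimately have "finite (gen I)"
        using finite_gen_of_conj_maximal[OF I _ _ yv(2) vmin] by blast
      thus False using L(3) gen_mono[of L I] finite_subset by (auto simp: I_def)
    qed
    hence sC: "s \<in> C" and comm: "\<And>r. r \<in> L \<Longrightarrow> r \<otimes> s = s \<otimes> r" using s sL by (auto simp: C_def)
    have "x \<otimes> s \<in> min_right L"
      unfolding min_right_def
    proof (intro CollectI conjI ballI)
      fix r assume r: "r \<in> L"
      hence rS: "r \<in> S" using L by auto
      have "x \<otimes> s \<otimes> r = x \<otimes> r \<otimes> s" using comm[OF r] xc sS rS by (simp add: m_assoc)
      moreover have "ell (x \<otimes> r) \<le> ell (x \<otimes> r \<otimes> s) + 1" using len_mult_gen[of "x \<otimes> r" s] xc sS rS by auto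
      ultimately show "ell (x \<otimes> s) < ell (x \<otimes> s \<otimes> r)" using xr[OF r] s by simp
    qed (use xc sS in simp)
    moreover have "conj_set W (x \<otimes> s) L = conj_set W x L"
    proof -
      have "conj_set W s L = L" unfolding conj_set_def
      proof -
        have "s \<otimes> a \<otimes> inv s = a" if "a \<in> L" for a
        proof -
          have "a \<in> S" using that L by auto
          have "s \<otimes> a \<otimes> inv s = a \<otimes> s \<otimes> inv s" using comm[OF that] by simp
          thus ?thesis using sS \<open>a \<in> S\<close> by (simp add: m_assoc)
        qed
        thus "(\<lambda>a. s \<otimes> a \<otimes> inv s) ` L = L" by simp
      qed
      thus ?thesis using conj_set_mult[OF xc gen_carrier[OF sS] L(1)] by simp
    qed
    ultimately have "x \<otimes> s \<in> gen C"
      using less.hyps[of "x \<otimes> s"] s less.prems unfolding C_def by simp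
    hence "x \<otimes> s \<otimes> s \<in> gen C" using gen_closed(2)[OF C _ gen_closed(4)[OF C sC]] by blast
    thus ?thesis using xc sS unfolding C_def by (simp add: m_assoc)
  qed
qed

section \<open>Reduction to spherical subsets\<close>

lemma gen_union_commuting:
  assumes A: "A \<subseteq> S" and B: "B \<subseteq> S" and comm: "\<And>a b. \<lbrakk>a \<in> A; b \<in> B\<rbrakk> \<Longrightarrow> a \<otimes> b = b \<otimes> a"
  shows "gen (A \<union> B) \<subseteq> (\<lambda>(a, b). a \<otimes> b) ` (gen A \<times> gen B)"
proof
  have AB: "A \<union> B \<subseteq> S" using A B by blast
  fix w assume "w \<in> gen (A \<union> B)"
  then obtain ws where ws: "ws \<in> lists (A \<union> B)" "ev ws = w" using gen_word[OF AB] by blast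
  have "\<exists>a\<in>gen A. \<exists>b\<in>gen B. ev ws = a \<otimes> b" using ws(1)
  proof (induction ws rule: list.induct)
    case Nil
    show ?case by (intro bexI[of _ \<one>]) (auto intro: generate.one)
  next
    case (Cons c ws)
    then obtain a b where ab: "a \<in> gen A" "b \<in> gen B" "ev ws = a \<otimes> b" by auto
    have carr: "a \<in> carrier W" "b \<in> carrier W" using ab gen_in_carrier A B by auto
    have c: "c \<in> A \<or> c \<in> B" "c \<in> carrier W" using Cons.prems AB by auto
    from c(1) show ?case
    proof
      assume "c \<in> A"
      moreover have "ev (c # ws) = (c \<otimes> a) \<otimes> b" using ab carr c by (simp add: m_assoc)
      ultimately show ?thesis using ab gen_closed(2)[OF A gen_closed(4)[OF A]] by blast
    next
      assume cB: "c \<in> B"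
      have "a \<otimes> c = c \<otimes> a" using gen_commutes[OF A c(2) _ ab(1)] comm cB by blast
      hence "ev (c # ws) = a \<otimes> (c \<otimes> b)" using ab carr c by (simp flip: m_assoc)
      thus ?thesis using ab gen_closed(2)[OF B gen_closed(4)[OF B cB]] by blast
    qed
  qed
  thus "w \<in> (\<lambda>(a, b). a \<otimes> b) ` (gen A \<times> gen B)" using ws(2) by auto
qed

text \<open>
  A subset of smallest cardinality with infinite parabolic subgroup will do: were it a disjoint
  union of two nonempty commuting parts, its parabolic subgroup would be a product of two finite ones.
\<close>

lemma ex_infinite_irreducible:
  assumes K: "finite K" "K \<subseteq> S" and inf: "infinite (gen K)"
  shows "\<exists>L \<subseteq> K. irreducible_gens L \<and> infinite (gen L)"
proof -
  define P where "P L \<longleftrightarrow> L \<subseteq> K \<and> infinite (gen L)" for L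
  have "P K" using inf by (simp add: P_def)
  then obtain L where L: "P L" "\<And>M. P M \<Longrightarrow> card L \<le> card M"
    using ex_has_least_nat[of P K card] by blast
  have finL: "finite L" using L K finite_subset by (auto simp: P_def)
  have small: "finite (gen M)" if "M \<subset> L" for M
    using L(2)[of M] L(1) psubset_card_mono[OF finL that] that by (auto simp: P_def)
  have "irreducible_gens L"
    unfolding irreducible_gens_def
  proof (intro allI impI, rule ccontr)
    fix A assume A: "A \<subseteq> L" "A \<noteq> {}" "A \<noteq> L" "\<not> (\<exists>a\<in>A. \<exists>b\<in>L - A. a \<otimes> b \<noteq> b \<otimes> a)"
    have "finite (gen A)" "finite (gen (L - A))" using A by (auto intro!: small)
    moreover have "gen (A \<union> (L - A)) \<subseteq> (\<lambda>(a, b). a \<otimes> b) ` (gen A \<times> gen (L - A))"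
      using A L(1) K by (intro gen_union_commuting) (auto simp: P_def)
    ultimately have "finite (gen (A \<union> (L - A)))" by (meson finite_SigmaI finite_imageI finite_subset)
    moreover have "A \<union> (L - A) = L" using A by blast
    ultimately show False using L(1) by (simp add: P_def)
  qed
  thus ?thesis using L(1) by (auto simp: P_def)
qed

text \<open>
  Take an irreducible subset with infinite parabolic subgroup of largest cardinality; adjoining an
  element that does not commute with it would preserve both properties.
\<close>

lemma ex_infinite_component:
  assumes K: "finite K" "K \<subseteq> S" and inf: "infinite (gen K)"
  shows "\<exists>L \<subseteq> K. irreducible_gens L \<and> infinite (gen L) \<and>
    (\<forall>k\<in>K - L. \<forall>r\<in>L. k \<otimes> r = r \<otimes> k)"
proof -
  define P where "P L \<longleftrightarrow> L \<subseteq> K \<and> irreducible_gens L \<and> infinite (gen L)" for L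
  obtain L0 where "P L0" using ex_infinite_irreducible[OF assms] by (auto simp: P_def)
  moreover have "\<forall>L. P L \<longrightarrow> card L < Suc (card K)"
    using card_mono[OF K(1)] by (auto simp: P_def le_imp_less_Suc)
  ultimately obtain L where L: "P L" "\<And>M. P M \<Longrightarrow> card M \<le> card L"
    using ex_has_greatest_nat[of P L0 card "Suc (card K)"] by blast
  have finL: "finite L" using L K finite_subset by (auto simp: P_def)
  have "k \<otimes> r = r \<otimes> k" if k: "k \<in> K - L" "r \<in> L" for k r
  proof (rule ccontr)
    assume "k \<otimes> r \<noteq> r \<otimes> k"
    hence "irreducible_gens (insert k L)"
      using irreducible_insert[of L r k] L(1) k by (auto simp: P_def)
    moreover have "infinite (gen (insert k L))"
      using L(1) gen_mono[of L "insert k L"] finite_subset by (auto simp: P_def)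
    ultimately have "P (insert k L)" using L(1) k by (auto simp: P_def)
    thus False using L(2)[of "insert k L"] finL k by simp
  qed
  thus ?thesis using L(1) by (auto simp: P_def)
qed

lemma finite_gen_conj_set:
  assumes K: "K \<subseteq> S" and x: "x \<in> carrier W" and J: "conj_set W x K \<subseteq> S" and fin: "finite (gen K)"
  shows "finite (gen (conj_set W x K))"
proof (rule finite_subset)
  show "gen (conj_set W x K) \<subseteq> (\<lambda>g. x \<otimes> g \<otimes> inv x) ` gen K"
  proof
    fix w assume "w \<in> gen (conj_set W x K)"
    then obtain ws where ws: "ws \<in> lists (conj_set W x K)" "ev ws = w" using gen_word[OF J] by blast
    have "\<exists>g\<in>gen K. ev ws = x \<otimes> g \<otimes> inv x" using ws(1)
    proof (induction ws rule: list.induct)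
      case Nil
      show ?case using x by (intro bexI[of _ \<one>]) (auto intro: generate.one)
    next
      case (Cons c ws)
      then obtain g where g: "g \<in> gen K" "ev ws = x \<otimes> g \<otimes> inv x" by auto
      obtain k where k: "k \<in> K" "c = x \<otimes> k \<otimes> inv x" using Cons.prems by (auto simp: conj_set_def)
      have "k \<in> carrier W" "g \<in> carrier W" using k g K gen_in_carrier by auto
      hence "ev (c # ws) = x \<otimes> (k \<otimes> g) \<otimes> inv x" using x k g by (simp add: m_assoc)
      thus ?case using gen_closed(2)[OF K gen_closed(4)[OF K k(1)] g(1)] by blast
    qed
    thus "w \<in> (\<lambda>g. x \<otimes> g \<otimes> inv x) ` gen K" using ws(2) by auto
  qed
qed (use fin in simp)

text \<open>
  By \<open>conj_infinite_irreducible\<close> the elements \<open>x\<close> on the left lie in \<open>W\<^sub>C\<close>, so they centralise \<open>L\<close>; in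
  particular \<open>L \<subseteq> J\<close>, and conjugation by \<open>x\<close> matches \<open>K - L\<close> with \<open>J - L\<close>. Conversely, elements of \<open>W\<^sub>C\<close> have no
  descents in \<open>L\<close>, since \<open>L\<close> and \<open>C\<close> are disjoint.
\<close>

lemma h_set_remove_infinite_component:
  assumes S: "finite S" and sub: "G \<subseteq> S" "J \<subseteq> G" "K \<subseteq> G"
    and L: "L \<subseteq> K" "irreducible_gens L" "infinite (gen L)"
    and comm: "\<And>k r. \<lbrakk>k \<in> K - L; r \<in> L\<rbrakk> \<Longrightarrow> k \<otimes> r = r \<otimes> k"
    and ne: "h_set W S G J J K \<noteq> {}"
  defines "C \<equiv> {s \<in> G - L. \<forall>r\<in>L. s \<otimes> r = r \<otimes> s}"
  shows "L \<subseteq> J \<and> J - L \<subseteq> C \<and> K - L \<subseteq> C \<and>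
    h_set W S G J J K = h_set W S C (J - L) (J - L) (K - L)"
proof -
  have JK: "J \<subseteq> S" "K \<subseteq> S" "L \<subseteq> S" "C \<subseteq> S" "C \<subseteq> G" using sub L by (auto simp: C_def)
  have xC: "x \<in> gen C" if x: "x \<in> h_set W S G J J K" for x
    unfolding C_def
  proof (rule conj_infinite_irreducible[OF S sub(1) JK(3) L(2,3)])
    have "x \<in> gen G" "x \<in> min_right K" using x double_reps_iff[OF JK(1,2) sub(1)] by (auto simp: h_set_def)
    thus "x \<in> gen G" "x \<in> min_right L" using min_right_mono[OF L(1)] by auto
    show "conj_set W x L \<subseteq> S" using x L(1) JK(1) by (auto simp: h_set_def conj_set_def)
  qed
  have fix_L: "x \<otimes> r \<otimes> inv x = r" if "x \<in> gen C" "r \<in> L" for x r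
  proof -
    have r: "r \<in> carrier W" and x: "x \<in> carrier W" using that JK gen_in_carrier by auto
    have "x \<otimes> r = r \<otimes> x" using gen_commutes[OF JK(4) r _ that(1)] that(2) by (auto simp: C_def)
    thus ?thesis using r x by (simp add: m_assoc)
  qed
  have conj_L: "conj_set W x L = L" if "x \<in> gen C" for x
    using fix_L[OF that] by (simp add: conj_set_def)
  have conj_diff: "conj_set W x (K - L) = conj_set W x K - L" if "x \<in> gen C" for x
  proof -
    have x: "x \<in> carrier W" using that gen_in_carrier[OF JK(4)] by blast
    have "inj_on (\<lambda>a. x \<otimes> a \<otimes> inv x) K"
    proof (rule inj_onI)
      fix a b assume "a \<in> K" "b \<in> K" "x \<otimes> a \<otimes> inv x = x \<otimes> b \<otimes> inv x"
      moreover from this have "a \<in> carrier W" "b \<in> carrier W" using JK by auto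
      ultimately show "a = b" using x by simp
    qed
    hence "conj_set W x (K - L) = conj_set W x K - conj_set W x L"
      unfolding conj_set_def using L(1) by (intro inj_on_image_set_diff[of _ K]) auto
    thus ?thesis using conj_L[OF that] by simp
  qed
  obtain x0 where x0: "x0 \<in> h_set W S G J J K" using ne by blast
  have conj0: "conj_set W x0 K = J" using x0 by (simp add: h_set_def)
  have x0c: "x0 \<in> carrier W" using xC[OF x0] gen_in_carrier[OF JK(4)] by blast
  have LJ: "L \<subseteq> J" using conj_L[OF xC[OF x0]] conj0 L(1) by (auto simp: conj_set_def)
  have KC: "K - L \<subseteq> C" using comm sub by (auto simp: C_def)
  have JC: "J - L \<subseteq> C"
  proof
    fix j assume j: "j \<in> J - L"
    then obtain k where k: "k \<in> K - L" "j = x0 \<otimes> k \<otimes> inv x0"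
      using conj_diff[OF xC[OF x0]] conj0 by (auto simp: conj_set_def)
    have kC: "k \<in> gen C" using KC k gen_closed(4)[OF JK(4)] by blast
    have "j \<in> gen C" unfolding k(2)
      by (intro gen_closed(2)[OF JK(4)] gen_closed(3)[OF JK(4)] kC xC[OF x0])
    hence "j \<otimes> r = r \<otimes> j" if "r \<in> L" for r
      using gen_commutes[OF JK(4), of r j] that JK(3) by (auto simp: C_def)
    thus "j \<in> C" using j sub by (auto simp: C_def)
  qed
  have "h_set W S G J J K = h_set W S C (J - L) (J - L) (K - L)"
  proof
    show "h_set W S G J J K \<subseteq> h_set W S C (J - L) (J - L) (K - L)"
    proof
      fix x assume x: "x \<in> h_set W S G J J K"
      thus "x \<in> h_set W S C (J - L) (J - L) (K - L)"
        using xC[OF x] conj_diff[OF xC[OF x]] by (auto simp: h_set_def double_reps_def)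
    qed
    show "h_set W S C (J - L) (J - L) (K - L) \<subseteq> h_set W S G J J K"
    proof
      fix x assume x: "x \<in> h_set W S C (J - L) (J - L) (K - L)"
      hence xC: "x \<in> gen C" by (simp add: h_set_def double_reps_def)
      have out: "ell x < ell (r \<otimes> x)" "ell x < ell (x \<otimes> r)" if "r \<in> L" for r
        using len_outside_gen[OF JK(4) _ _ xC, of r] that JK(3) by (auto simp: C_def)
      have "conj_set W x K = conj_set W x (K - L) \<union> conj_set W x L"
        unfolding conj_set_def image_Un[symmetric] using L(1) by (auto simp: Un_absorb1)
      also have "\<dots> = J" using x conj_L[OF xC] LJ by (auto simp: h_set_def)
      finally have "conj_set W x K = J" .
      moreover have "x \<in> double_reps W S G J K"
        using x out gen_mono[OF JK(5)] by (auto simp: h_set_def double_reps_def)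
      ultimately show "x \<in> h_set W S G J J K" by (simp add: h_set_def)
    qed
  qed
  thus ?thesis using LJ KC JC by blast
qed

text \<open>
  Remove infinite components until \<open>K\<close> is spherical. If the set is nonempty then \<open>J\<close> is conjugate to \<open>K\<close>, so
  \<open>J\<close> is spherical as well.
\<close>

lemma rational_h_of_spherical:
  assumes S: "finite S"
    and sph: "\<And>G J K. \<lbrakk>G \<subseteq> S; J \<subseteq> G; K \<subseteq> G; card J = card K; spherical W J; spherical W K\<rbrakk> \<Longrightarrow>
      rational_fps (poincare W S (h_set W S G J J K))"
    and "G \<subseteq> S" "J \<subseteq> G" "K \<subseteq> G" "card J = card K"
  shows "rational_fps (poincare W S (h_set W S G J J K))"
  using assms(3-)
proof (induction "card K" arbitrary: G J K rule: less_induct)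
  case less
  have JK: "J \<subseteq> S" "K \<subseteq> S" "finite K" "finite J"
    using less.prems finite_subset[OF _ S] by (auto simp: subset_iff)
  show ?case
  proof (cases "h_set W S G J J K = {}")
    case False
    show ?thesis
    proof (cases "finite (gen K)")
      case True
      obtain x where x: "x \<in> h_set W S G J J K" using False by blast
      have xc: "x \<in> carrier W" using x h_set_carrier[OF less.prems(1)] by blast
      have "conj_set W x K = J" using x by (simp add: h_set_def)
      hence "finite (gen J)" using finite_gen_conj_set[OF JK(2) xc _ True] JK(1) by simp
      thus ?thesis using sph less.prems True by (simp add: spherical_def)
    next
      case inf: False
      obtain L where L: "L \<subseteq> K" "irreducible_gens L" "infinite (gen L)"
        "\<forall>k\<in>K - L. \<forall>r\<in>L. k \<otimes> r = r \<otimes> k"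
        using ex_infinite_component[OF JK(3,2) inf] by blast
      define C where "C = {s \<in> G - L. \<forall>r\<in>L. s \<otimes> r = r \<otimes> s}"
      have red: "L \<subseteq> J \<and> J - L \<subseteq> C \<and> K - L \<subseteq> C \<and>
        h_set W S G J J K = h_set W S C (J - L) (J - L) (K - L)"
        unfolding C_def
        by (rule h_set_remove_infinite_component[OF S less.prems(1-3) L(1-3) _ False]) (use L(4) in blast)
      have finL: "finite L" using L(1) JK(3) finite_subset by blast
      have "L \<noteq> {}" using L(3) gen_empty by auto
      hence "K - L \<subset> K" using L(1) by blast
      hence "card (K - L) < card K" using psubset_card_mono JK(3) by blast
      moreover have "card (J - L) = card (K - L)"
        using card_Diff_subset[OF finL] L(1) red less.prems(4) by simp
      moreover have "C \<subseteq> S" using less.prems(1) by (auto simp: C_def)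
      ultimately have "rational_fps (poincare W S (h_set W S C (J - L) (J - L) (K - L)))"
        using less.hyps red by blast
      thus ?thesis using red by simp
    qed
  qed simp
qed

end

theorem theorem2p20:
  fixes W :: "('a, 'b) monoid_scheme" and S :: "'a set"
  assumes "coxeter_system W S" and "finite S"
  shows
    "let
       p = (\<lambda>S' Q J K. poincare W S (p_set W S S' Q J K));
       h = (\<lambda>S' R J K. poincare W S (h_set W S S' R J K));
       c1 = (\<forall>S' Q J K. S' \<subseteq> S \<longrightarrow> Q \<subseteq> S' \<longrightarrow> J \<subseteq> S' \<longrightarrow> K \<subseteq> S' \<longrightarrow>
              rational_fps (p S' Q J K));
       c2 = (\<forall>S' Q J K. S' \<subseteq> S \<longrightarrow> Q \<subseteq> S' \<longrightarrow> J \<subseteq> S' \<longrightarrow> K \<subseteq> S' \<longrightarrow>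
              card K + 1 = card S' \<longrightarrow> rational_fps (p S' Q J K));
       c3 = (\<forall>S' J K. S' \<subseteq> S \<longrightarrow> J \<subseteq> S' \<longrightarrow> K \<subseteq> S' \<longrightarrow>
              rational_fps (p S' K J K));
       c4 = (\<forall>S' R J K. S' \<subseteq> S \<longrightarrow> J \<subseteq> S' \<longrightarrow> K \<subseteq> S' \<longrightarrow> R \<subseteq> J \<longrightarrow>
              rational_fps (h S' R J K));
       c5 = (\<forall>S' R J K. S' \<subseteq> S \<longrightarrow> J \<subseteq> S' \<longrightarrow> K \<subseteq> S' \<longrightarrow> R \<subseteq> J \<longrightarrow>
              card J + 1 = card S' \<longrightarrow> rational_fps (h S' R J K));
       c6 = (\<forall>S' J K. S' \<subseteq> S \<longrightarrow> J \<subseteq> S' \<longrightarrow> K \<subseteq> S' \<longrightarrow> card J = card K \<longrightarrow>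
              p S' K J K = h S' J J K \<and> rational_fps (p S' K J K));
       c7 = (\<forall>S' J K. S' \<subseteq> S \<longrightarrow> J \<subseteq> S' \<longrightarrow> K \<subseteq> S' \<longrightarrow> card J = card K \<longrightarrow>
              spherical W J \<longrightarrow> spherical W K \<longrightarrow> rational_fps (p S' K J K))
     in
       (\<forall>S' J K. S' \<subseteq> S \<longrightarrow> J \<subseteq> S' \<longrightarrow> K \<subseteq> S' \<longrightarrow> card J = card K \<longrightarrow>
          p S' K J K = h S' J J K) \<and>
       (c1 \<longleftrightarrow> c2) \<and> (c2 \<longleftrightarrow> c3) \<and> (c3 \<longleftrightarrow> c4) \<and> (c4 \<longleftrightarrow> c5) \<and> (c5 \<longleftrightarrow> c6) \<and> (c6 \<longleftrightarrow> c7) \<and>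
       (c1 \<longrightarrow> (\<forall>S' J K. S' \<subseteq> S \<longrightarrow> J \<subseteq> S' \<longrightarrow> K \<subseteq> S' \<longrightarrow>
                  rational_fps (poincare W S (double_reps W S S' J K))))"
proof -
  interpret coxeter_system W S by (rule assms(1))
  note S = \<open>finite S\<close>
  define p where "p S' Q J K = poincare W S (p_set W S S' Q J K)" for S' Q J K
  define h where "h S' R J K = poincare W S (h_set W S S' R J K)" for S' R J K
  define c1 where "c1 \<longleftrightarrow> (\<forall>S' Q J K. S' \<subseteq> S \<longrightarrow> Q \<subseteq> S' \<longrightarrow> J \<subseteq> S' \<longrightarrow> K \<subseteq> S' \<longrightarrow>
              rational_fps (p S' Q J K))"
  define c2 where "c2 \<longleftrightarrow> (\<forall>S' Q J K. S' \<subseteq> S \<longrightarrow> Q \<subseteq> S' \<longrightarrow> J \<subseteq> S' \<longrightarrow> K \<subseteq> S' \<longrightarrow>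
              card K + 1 = card S' \<longrightarrow> rational_fps (p S' Q J K))"
  define c3 where "c3 \<longleftrightarrow> (\<forall>S' J K. S' \<subseteq> S \<longrightarrow> J \<subseteq> S' \<longrightarrow> K \<subseteq> S' \<longrightarrow>
              rational_fps (p S' K J K))"
  define c4 where "c4 \<longleftrightarrow> (\<forall>S' R J K. S' \<subseteq> S \<longrightarrow> J \<subseteq> S' \<longrightarrow> K \<subseteq> S' \<longrightarrow> R \<subseteq> J \<longrightarrow>
              rational_fps (h S' R J K))"
  define c5 where "c5 \<longleftrightarrow> (\<forall>S' R J K. S' \<subseteq> S \<longrightarrow> J \<subseteq> S' \<longrightarrow> K \<subseteq> S' \<longrightarrow> R \<subseteq> J \<longrightarrow>
              card J + 1 = card S' \<longrightarrow> rational_fps (h S' R J K))"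
  define c6 where "c6 \<longleftrightarrow> (\<forall>S' J K. S' \<subseteq> S \<longrightarrow> J \<subseteq> S' \<longrightarrow> K \<subseteq> S' \<longrightarrow> card J = card K \<longrightarrow>
              p S' K J K = h S' J J K \<and> rational_fps (p S' K J K))"
  define c7 where "c7 \<longleftrightarrow> (\<forall>S' J K. S' \<subseteq> S \<longrightarrow> J \<subseteq> S' \<longrightarrow> K \<subseteq> S' \<longrightarrow> card J = card K \<longrightarrow>
              spherical W J \<longrightarrow> spherical W K \<longrightarrow> rational_fps (p S' K J K))"
  have eq: "p S' K J K = h S' J J K" if "S' \<subseteq> S" "J \<subseteq> S'" "K \<subseteq> S'" "card J = card K" for S' J K
    using p_set_diag_eq_h_set[OF S that(1) _ _ that(4)] that by (simp add: p_def h_def)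
  have 12: "c2" if "c1" using that unfolding c1_def c2_def by blast
  have 21: "c1" if "c2"
  proof -
    have "rational_fps (p S' Q J K)" if "S' \<subseteq> S" "J \<subseteq> S'" "K \<subseteq> S'" for S' Q J K
      unfolding p_def using \<open>c2\<close> rational_p_of_maximal[OF S _ that] unfolding c2_def p_def by simp
    thus ?thesis unfolding c1_def by blast
  qed
  have 13: "c3" if "c1" using that unfolding c1_def c3_def by blast
  have 31: "c1" if "c3"
  proof -
    have "rational_fps (p S' Q J K)" if "S' \<subseteq> S" "J \<subseteq> S'" "K \<subseteq> S'" for S' Q J K
      unfolding p_def using \<open>c3\<close> rational_p_of_diag[OF S _ that] unfolding c3_def p_def by simp
    thus ?thesis unfolding c1_def by blast
  qed
  have 36: "c6" if "c3" using that eq unfolding c3_def c6_def by blast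
  have 64: "c4" if "c6"
  proof -
    have bal: "rational_fps (poincare W S (h_set W S L J J K))"
      if "L \<subseteq> S" "J \<subseteq> L" "K \<subseteq> L" "card J = card K" for L J K
      using \<open>c6\<close> that unfolding c6_def h_def by metis
    show ?thesis unfolding c4_def h_def using rational_h_of_balanced[OF S bal] by blast
  qed
  have 43: "c3" if "c4"
  proof -
    have "rational_fps (p S' K J K)" if sub: "S' \<subseteq> S" "J \<subseteq> S'" "K \<subseteq> S'" for S' J K
    proof -
      have "rational_fps (h S' R J K)" if "R \<in> Pow J" for R
        using \<open>c4\<close> sub that unfolding c4_def by simp
      moreover have "p S' K J K = (\<Sum>R\<in>Pow J. h S' R J K)"
        unfolding p_def h_def using sub by (intro poincare_p_diag_sum_h[OF S]) auto
      ultimately show ?thesis using rational_fps_sum[of "Pow J"] by simp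
    qed
    thus ?thesis unfolding c3_def by blast
  qed
  have 45: "c5" if "c4" using that unfolding c4_def c5_def by blast
  have 54: "c4" if "c5"
  proof -
    have "rational_fps (h S' R J K)" if "S' \<subseteq> S" "J \<subseteq> S'" "K \<subseteq> S'" "R \<subseteq> J" for S' R J K
      unfolding h_def using \<open>c5\<close> rational_h_of_maximal[OF S _ that] unfolding c5_def h_def by simp
    thus ?thesis unfolding c4_def by blast
  qed
  have 67: "c7" if "c6" using that unfolding c6_def c7_def by blast
  have 76: "c6" if "c7"
  proof -
    have sph: "rational_fps (poincare W S (h_set W S G J J K))"
      if "G \<subseteq> S" "J \<subseteq> G" "K \<subseteq> G" "card J = card K" "spherical W J" "spherical W K" for G J K
      using \<open>c7\<close> that eq[OF that(1-4)] unfolding c7_def h_def by metis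
    have "rational_fps (p S' K J K)" if "S' \<subseteq> S" "J \<subseteq> S'" "K \<subseteq> S'" "card J = card K" for S' J K
      using rational_h_of_spherical[OF S sph that] unfolding eq[OF that] h_def .
    thus ?thesis unfolding c6_def using eq by blast
  qed
  have reps: "rational_fps (poincare W S (double_reps W S S' J K))"
    if "c1" and sub: "S' \<subseteq> S" "J \<subseteq> S'" "K \<subseteq> S'" for S' J K
  proof -
    have "rational_fps (p S' Q J K)" if "Q \<in> Pow K" for Q
    proof -
      have "Q \<subseteq> S'" using that sub(3) by auto
      thus ?thesis using \<open>c1\<close> sub unfolding c1_def by simp
    qed
    moreover have "poincare W S (double_reps W S S' J K) = (\<Sum>Q\<in>Pow K. p S' Q J K)"
      unfolding p_def using sub by (intro poincare_double_reps_sum_p[OF S]) auto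
    ultimately show ?thesis using rational_fps_sum[of "Pow K"] by simp
  qed
  have "\<forall>S' J K. S' \<subseteq> S \<longrightarrow> J \<subseteq> S' \<longrightarrow> K \<subseteq> S' \<longrightarrow> card J = card K \<longrightarrow>
          p S' K J K = h S' J J K"
    by (intro impI allI) (rule eq)
  moreover have "c1 \<longleftrightarrow> c2" using 12 21 by blast
  moreover have "c2 \<longleftrightarrow> c3" using 21 13 31 12 by blast
  moreover have "c3 \<longleftrightarrow> c4" using 36 64 43 by blast
  moreover have "c4 \<longleftrightarrow> c5" using 45 54 by blast
  moreover have "c5 \<longleftrightarrow> c6" using 54 43 36 64 45 by blast
  moreover have "c6 \<longleftrightarrow> c7" using 67 76 by blast
  moreover have "c1 \<longrightarrow> (\<forall>S' J K. S' \<subseteq> S \<longrightarrow> J \<subseteq> S' \<longrightarrow> K \<subseteq> S' \<longrightarrow>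
                  rational_fps (poincare W S (double_reps W S S' J K)))"
    by (intro impI allI) (rule reps)
  ultimately have "(\<forall>S' J K. S' \<subseteq> S \<longrightarrow> J \<subseteq> S' \<longrightarrow> K \<subseteq> S' \<longrightarrow> card J = card K \<longrightarrow>
          p S' K J K = h S' J J K) \<and>
       (c1 \<longleftrightarrow> c2) \<and> (c2 \<longleftrightarrow> c3) \<and> (c3 \<longleftrightarrow> c4) \<and> (c4 \<longleftrightarrow> c5) \<and> (c5 \<longleftrightarrow> c6) \<and> (c6 \<longleftrightarrow> c7) \<and>
       (c1 \<longrightarrow> (\<forall>S' J K. S' \<subseteq> S \<longrightarrow> J \<subseteq> S' \<longrightarrow> K \<subseteq> S' \<longrightarrow>
                  rational_fps (poincare W S (double_reps W S S' J K))))"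
    by (intro conjI)
  thus ?thesis unfolding Let_def c1_def c2_def c3_def c4_def c5_def c6_def c7_def p_def h_def .
qed

end
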